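(* Let $\mathcal{G}_{n,n+2}$ denote the set of connected simple graphs with $n$ vertices and $n+2$ edges. The graph with minimal energy in $\mathcal{G}_{n,n+2}$ is: the complete graph $K_4$ if $n=4$; $S_{n,n+2}$ if $n=5$ or $n\geq 10$; $B_{n,n+2}$ if $6\leq n\leq 9$. Furthermore, $S_{6,8}$ has second-minimal energy in $\mathcal{G}_{6,8}$.
   Context: All graphs are finite and simple. The energy of a graph $G$ is $E(G)=\sum_{i=1}^n|\lambda_i|$, where $\lambda_1,\dots,\lambda_n$ are the eigenvalues of the adjacency matrix of $G$. For $n-1\le e$, $S_{n,e}$ is the graph obtained from the star $S_n$ on $n$ vertices (center $v$) by adding $e-n+1$ edges among the leaves, all incident to one common leaf $u$. $B_{n,e}$ denotes the connected bipartite graph with $n$ vertices and $e$ edges having two vertices $a,b$ on one side and $n-2$ vertices on the other side, where $a$ is adjacent to all $n-2$ vertices of the other side. *)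

theory Defs
  imports "Graph_Theory.Graph_Theory" "Jordan_Normal_Form.Spectral_Radius"
begin

text \<open>
  A finite simple graph is a \<^locale>\<open>pair_graph\<close>: a finite vertex set with a symmetric, irreflexive
  arc relation on it.  An undirected edge is thus a pair of opposite arcs, so the edges are counted
  as two-element vertex sets and not as arcs.
\<close>

definition uedges :: "'a pair_pre_digraph \<Rightarrow> 'a set set" where
  "uedges G = (\<lambda>(u, v). {u, v}) ` parcs G"

definition conn_graphs :: "nat \<Rightarrow> nat \<Rightarrow> 'a pair_pre_digraph set" where
  "conn_graphs n e =
    {G. pair_graph G \<and> Digraph_Component.connected (with_proj G) \<and>
        card (pverts G) = n \<and> card (uedges G) = e}"

definition adj_mat :: "'a list \<Rightarrow> 'a pair_pre_digraph \<Rightarrow> complex mat" where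
  "adj_mat xs G = mat (length xs) (length xs) (\<lambda>(i, j). if (xs ! i, xs ! j) \<in> parcs G then 1 else 0)"

text \<open>
  The algebraic multiplicity of an eigenvalue is its order as a root of the characteristic polynomial.
\<close>

definition mat_energy :: "complex mat \<Rightarrow> real" where
  "mat_energy A = (\<Sum>z \<in> spectrum A. real (Polynomial.order z (char_poly A)) * cmod z)"

text \<open>
  The adjacency matrix depends on an enumeration of the vertices; by \<open>energy_eq\<close> below the energy
  does not.
\<close>

definition energy :: "'a pair_pre_digraph \<Rightarrow> real" where
  "energy G = mat_energy (adj_mat (SOME xs. distinct xs \<and> set xs = pverts G) G)"

text \<open>The graph with vertex set \<open>{0..<n}\<close> in which u, v are adjacent iff R u v or R v u.\<close>

definition graph_of :: "nat \<Rightarrow> (nat \<Rightarrow> nat \<Rightarrow> bool) \<Rightarrow> nat pair_pre_digraph" where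
  "graph_of n R =
    \<lparr>pverts = {0..<n}, parcs = {(u, v). u < n \<and> v < n \<and> u \<noteq> v \<and> (R u v \<or> R v u)}\<rparr>"

text \<open>
  \<open>S_graph n e\<close>: the centre is 0 and the common leaf is 1, which is joined to the
  e - n + 1 further leaves 2, ..., e - n + 2.
  \<open>B_graph n e\<close>: the small side is {0, 1}, vertex 0 is joined to all of 2, ..., n - 1, and vertex 1
  to the e - (n - 2) vertices 2, ..., e - n + 3.
  The bounds are written additively to avoid truncated subtraction.  The edge numbers are e only
  for n - 1 \<le> e \<le> 2 n - 3 and n - 2 \<le> e \<le> 2 n - 4 respectively.
\<close>

definition S_graph :: "nat \<Rightarrow> nat \<Rightarrow> nat pair_pre_digraph" where
  "S_graph n e = graph_of n (\<lambda>u v. u = 0 \<or> u = 1 \<and> 2 \<le> v \<and> v + n < e + 3)"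

definition B_graph :: "nat \<Rightarrow> nat \<Rightarrow> nat pair_pre_digraph" where
  "B_graph n e = graph_of n (\<lambda>u v. u = 0 \<and> 2 \<le> v \<or> u = 1 \<and> 2 \<le> v \<and> v + n < e + 4)"

definition isomorphic :: "'a pair_pre_digraph \<Rightarrow> 'b pair_pre_digraph \<Rightarrow> bool"  (infix "\<simeq>\<^sub>G" 50) where
  "G \<simeq>\<^sub>G H \<longleftrightarrow> digraph_iso (with_proj G) (with_proj H)"

definition minimal_energy :: "nat \<Rightarrow> nat \<Rightarrow> 'a pair_pre_digraph \<Rightarrow> bool" where
  "minimal_energy n e = is_arg_min energy (\<lambda>G. G \<in> conn_graphs n e)"

definition second_minimal_energy :: "nat \<Rightarrow> nat \<Rightarrow> 'a pair_pre_digraph \<Rightarrow> bool" where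
  "second_minimal_energy n e =
    is_arg_min energy (\<lambda>G. G \<in> conn_graphs n e \<and> \<not> minimal_energy n e G)"

lemma mat_energy_similar:
  assumes "similar_mat A B"
  shows "mat_energy A = mat_energy B"
proof -
  from similar_matD[OF assms] obtain n where "A \<in> carrier_mat n n" "B \<in> carrier_mat n n" by blast
  then have "spectrum A = spectrum B"
    using char_poly_similar[OF assms] by (simp add: spectrum_root_char_poly)
  then show ?thesis
    using char_poly_similar[OF assms] by (simp add: mat_energy_def)
qed

lemma similar_adj_mat:
  assumes "distinct xs" "distinct ys" "set xs = set ys"
  shows "similar_mat (adj_mat xs G) (adj_mat ys G)"
proof -
  define n where "n = length xs"
  have ny: "length ys = n" using assms distinct_card n_def by metis
  define P :: "complex mat" where "P = mat n n (\<lambda>(i, j). if xs ! i = ys ! j then 1 else 0)"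
  define Q :: "complex mat" where "Q = mat n n (\<lambda>(i, j). if ys ! i = xs ! j then 1 else 0)"
  have ex: "\<exists>k<n. ys ! k = xs ! i" if "i < n" for i
    using that assms(3) ny n_def by (metis in_set_conv_nth nth_mem)
  have ex': "\<exists>k<n. xs ! k = ys ! i" if "i < n" for i
    using that assms(3) ny n_def by (metis in_set_conv_nth nth_mem)
  have pick: "(\<Sum>k = 0..<n. (if ys ! k = a then 1 else 0) * f k) = f k0"
    if "k0 < n" "ys ! k0 = a" for a k0 and f :: "nat \<Rightarrow> complex"
  proof -
    have "(\<Sum>k = 0..<n. (if ys ! k = a then 1 else 0) * f k) = (\<Sum>k = 0..<n. if k = k0 then f k else 0)"
      using that assms(2) ny by (intro sum.cong) (auto simp: nth_eq_iff_index_eq)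
    then show ?thesis using that by simp
  qed
  have pick': "(\<Sum>k = 0..<n. (if xs ! k = a then 1 else 0) * f k) = f k0"
    if "k0 < n" "xs ! k0 = a" for a k0 and f :: "nat \<Rightarrow> complex"
  proof -
    have "(\<Sum>k = 0..<n. (if xs ! k = a then 1 else 0) * f k) = (\<Sum>k = 0..<n. if k = k0 then f k else 0)"
      using that assms(1) n_def by (intro sum.cong) (auto simp: nth_eq_iff_index_eq)
    then show ?thesis using that by simp
  qed
  let ?A = "adj_mat xs G" and ?B = "adj_mat ys G"
  have AQ: "P * ?B * Q = ?A"
  proof (rule eq_matI)
    fix i j assume "i < dim_row ?A" "j < dim_col ?A"
    then have ij: "i < n" "j < n" by (auto simp: adj_mat_def n_def)
    obtain i' where i': "i' < n" "ys ! i' = xs ! i" using ex ij by blast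
    obtain j' where j': "j' < n" "ys ! j' = xs ! j" using ex ij by blast
    have PB: "(P * ?B) $$ (i, k) = ?B $$ (i', k)" if "k < n" for k
    proof -
      have "(P * ?B) $$ (i, k) = (\<Sum>l = 0..<n. (if ys ! l = xs ! i then 1 else 0) * ?B $$ (l, k))"
        using that ij ny by (auto simp: P_def adj_mat_def scalar_prod_def intro!: sum.cong)
      then show ?thesis using pick[OF i'] by simp
    qed
    have "(P * ?B * Q) $$ (i, j) = (\<Sum>k = 0..<n. (P * ?B) $$ (i, k) * Q $$ (k, j))"
      using ij ny by (auto simp: P_def Q_def adj_mat_def scalar_prod_def intro!: sum.cong)
    also have "\<dots> = (\<Sum>k = 0..<n. (if ys ! k = xs ! j then 1 else 0) * ?B $$ (i', k))"
      using ij PB by (intro sum.cong) (auto simp: Q_def)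
    also have "\<dots> = ?B $$ (i', j')" using pick[OF j'] by simp
    also have "\<dots> = ?A $$ (i, j)"
      using ij i' j' ny by (simp add: adj_mat_def n_def)
    finally show "(P * ?B * Q) $$ (i, j) = ?A $$ (i, j)" .
  qed (auto simp: P_def Q_def adj_mat_def n_def)
  have PQ: "P * Q = 1\<^sub>m n"
  proof (rule eq_matI)
    fix i j assume "i < dim_row (1\<^sub>m n :: complex mat)" "j < dim_col (1\<^sub>m n :: complex mat)"
    then have ij: "i < n" "j < n" by auto
    obtain i' where i': "i' < n" "ys ! i' = xs ! i" using ex ij by blast
    have "(P * Q) $$ (i, j) = (\<Sum>k = 0..<n. (if ys ! k = xs ! i then 1 else 0) * Q $$ (k, j))"
      using ij by (auto simp: P_def Q_def scalar_prod_def intro!: sum.cong)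
    also have "\<dots> = Q $$ (i', j)" using pick[OF i'] by simp
    also have "\<dots> = 1\<^sub>m n $$ (i, j)"
      using ij i' assms(1) n_def by (auto simp: Q_def nth_eq_iff_index_eq)
    finally show "(P * Q) $$ (i, j) = 1\<^sub>m n $$ (i, j)" .
  qed (auto simp: P_def Q_def)
  have QP: "Q * P = 1\<^sub>m n"
  proof (rule eq_matI)
    fix i j assume "i < dim_row (1\<^sub>m n :: complex mat)" "j < dim_col (1\<^sub>m n :: complex mat)"
    then have ij: "i < n" "j < n" by auto
    obtain i' where i': "i' < n" "xs ! i' = ys ! i" using ex' ij by blast
    have "(Q * P) $$ (i, j) = (\<Sum>k = 0..<n. (if xs ! k = ys ! i then 1 else 0) * P $$ (k, j))"
      using ij by (auto simp: P_def Q_def scalar_prod_def intro!: sum.cong)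
    also have "\<dots> = P $$ (i', j)" using pick'[OF i'] by simp
    also have "\<dots> = 1\<^sub>m n $$ (i, j)"
      using ij i' assms(2) ny by (auto simp: P_def nth_eq_iff_index_eq)
    finally show "(Q * P) $$ (i, j) = 1\<^sub>m n $$ (i, j)" .
  qed (auto simp: P_def Q_def)
  show ?thesis
    using AQ PQ QP ny
    by (intro similar_matI[of _ _ P Q n]) (auto simp: P_def Q_def adj_mat_def n_def)
qed

lemma energy_eq:
  assumes "distinct xs" "set xs = pverts G"
  shows "energy G = mat_energy (adj_mat xs G)"
proof -
  let ?ys = "SOME xs. distinct xs \<and> set xs = pverts G"
  have "distinct ?ys \<and> set ?ys = pverts G"
    by (rule someI[of "\<lambda>xs. distinct xs \<and> set xs = pverts G" xs]) (use assms in blast)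
  then show ?thesis
    unfolding energy_def using assms by (intro mat_energy_similar similar_adj_mat) auto
qed

lemma pair_graph_graph_of: "pair_graph (graph_of n R)"
proof -
  have "parcs (graph_of n R) \<subseteq> {0..<n} \<times> {0..<n}" by (auto simp: graph_of_def)
  then have "finite (parcs (graph_of n R))" by (rule finite_subset) simp
  then show ?thesis
    by unfold_locales (auto simp: graph_of_def symmetric_def sym_def)
qed

end

theory Submission
  imports Defs
begin

text \<open>
  Let p be half the energy, m = n + 2 the number of edges, t the number of triangles and b_4 the
  coefficient of x^(n-4) in the characteristic polynomial.  Newton's identities for the positive and
  for the negative eigenvalues separately give
  \<open>p\<^sup>2 (p\<^sup>2 - m)\<^sup>2 \<ge> 4 t\<^sup>2 + 4 p\<^sup>2 b_4\<close>,
  with equality when there are at most two positive and at most two negative eigenvalues.  This is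
  the case for S and B, which have a vertex cover of size two.  So it remains to bound b_4 from below:
  if some vertex is adjacent to all others, then b_4 \<ge> 3 (n - 5) and t \<ge> 3, with equality in both only
  for S; otherwise b_4 \<ge> 4 (n - 6) for n \<ge> 6, with equality only for B.  The latter goes by removing
  a pendant vertex; without pendant vertices the degrees satisfy \<open>\<Sum>(d - 2) = 4\<close>, so almost all of
  them are 2 and b_4 grows quadratically in n.
\<close>

section \<open>Closed walks in simple graphs\<close>

text \<open>Let x and y be e_2 of the positive eigenvalues and of the absolute values of the
  negative ones. As the trace vanishes, both parts have sum p. Then x + y = p^2 - m, while p (y - x)
  is 2 t and x y is b_4, each up to terms in e_3 and e_4 of the parts. The inequality thus comes
  from (x + y)^2 = (y - x)^2 + 4 x y, and it is the splitting by sign that brings in the triangles.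
  The bounds on n come from weighing t^2 against p^2 b_4, where p^2 \<ge> n + 2. One has 4 (n - 6)
  \<le> 3 (n - 5) exactly for n \<le> 9; at n = 9 both sides agree, and B wins because it has no
  triangle. For n \<ge> 10 the triangles of S contribute 4 * 9, but one more unit of b_4 contributes
  4 p^2 \<ge> 4 * 12. At n = 5 there is no B, and a graph without dominating vertex has b_4 = 2
  against 0. At n = 6, with B excluded, it has b_4 \<ge> 4 against 3; here p^2 \<ge> 8 falls short
  of the required p^2 > 9, which the equation for S supplies. The main obstacle is order 6 without
  pendant vertices, where the general estimate of closed walks is too weak and the degrees have to
  be examined one by one.\<close>

definition nb :: "'a rel \<Rightarrow> 'a \<Rightarrow> 'a set" where
  "nb E u = E `` {u}"

definition deg :: "'a rel \<Rightarrow> 'a \<Rightarrow> nat" where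
  "deg E u = card (nb E u)"

definition cod :: "'a rel \<Rightarrow> 'a \<Rightarrow> 'a \<Rightarrow> nat" where
  "cod E u v = card (nb E u \<inter> nb E v)"

text \<open>
  walks3 and walks4 count closed walks, so they are the traces of the third and fourth power of the
  adjacency matrix.  quad is 8 b_4, because 8 e_4 = p_2^2 - 2 p_4 when the first power sum vanishes.
\<close>

definition walks3 :: "'a rel \<Rightarrow> nat" where
  "walks3 E = (\<Sum>(u, v) \<in> E. cod E u v)"

definition walks4 :: "'a set \<Rightarrow> 'a rel \<Rightarrow> nat" where
  "walks4 V E = (\<Sum>u\<in>V. \<Sum>v\<in>V. (cod E u v)\<^sup>2)"

definition quad :: "'a set \<Rightarrow> 'a rel \<Rightarrow> int" where
  "quad V E = (int (card E))\<^sup>2 - 2 * int (walks4 V E)"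

text \<open>Connectedness phrased by cuts: it yields positive degrees at once and passes to the
  deletion of a pendant vertex without handling paths.\<close>

definition no_cut :: "'a set \<Rightarrow> 'a rel \<Rightarrow> bool" where
  "no_cut V E \<longleftrightarrow> (\<forall>S. S \<subseteq> V \<and> S \<noteq> {} \<and> S \<noteq> V \<longrightarrow> (\<exists>u\<in>S. \<exists>v\<in>V - S. (u, v) \<in> E))"

definition cone :: "'a set \<Rightarrow> 'a rel \<Rightarrow> bool" where
  "cone V E \<longleftrightarrow> (\<exists>z\<in>V. \<forall>v\<in>V - {z}. (z, v) \<in> E)"

lemma in_nb [simp]: "v \<in> nb E u \<longleftrightarrow> (u, v) \<in> E"
  by (simp add: nb_def)

lemma cod_self [simp]: "cod E u u = deg E u"
  by (simp add: cod_def deg_def)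

lemma cod_commute: "cod E u v = cod E v u"
  by (simp add: cod_def Int_commute)

locale sgraph =
  fixes V :: "'a set" and E :: "'a rel"
  assumes finite_V [simp]: "finite V" and E_sub: "E \<subseteq> V \<times> V"
    and E_sym: "(u, v) \<in> E \<Longrightarrow> (v, u) \<in> E" and E_irr [simp]: "(u, u) \<notin> E"
begin

lemma finite_E [simp]: "finite E"
  using E_sub finite_subset by fastforce

lemma in_V: "(u, v) \<in> E \<Longrightarrow> u \<in> V" "(u, v) \<in> E \<Longrightarrow> v \<in> V"
  using E_sub by auto

lemma E_commute: "(u, v) \<in> E \<longleftrightarrow> (v, u) \<in> E"
  using E_sym by blast

lemma nb_sub: "nb E u \<subseteq> V" "nb E u \<subseteq> V - {u}"
  using E_sub by auto

lemma finite_nb [simp]: "finite (nb E u)"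
  using nb_sub finite_V finite_subset by metis

lemma cod_le: "cod E u v \<le> deg E u" "cod E u v \<le> deg E v"
  unfolding cod_def deg_def by (auto intro!: card_mono)

lemma cod_adj_less:
  assumes "(u, v) \<in> E" shows "cod E u v < deg E u" "cod E u v < deg E v"
proof -
  have "nb E u \<inter> nb E v \<subset> nb E u" "nb E u \<inter> nb E v \<subset> nb E v"
    using assms E_sym[OF assms] E_irr unfolding nb_def by blast+
  then show "cod E u v < deg E u" "cod E u v < deg E v"
    unfolding cod_def deg_def by (auto intro!: psubset_card_mono)
qed

lemma sum_arcs: "(\<Sum>(u, v)\<in>E. f u v) = (\<Sum>u\<in>V. \<Sum>v\<in>nb E u. f u v)"
proof -
  have "E = Sigma V (nb E)" using E_sub by auto
  then show ?thesis by (metis finite_V finite_nb sum.Sigma)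
qed

lemma sum_deg: "(\<Sum>u\<in>V. deg E u) = card E"
  using sum_arcs[of "\<lambda>_ _. 1 :: nat"] by (simp add: deg_def case_prod_unfold)

lemma sum_swap_nb: "(\<Sum>u\<in>V. \<Sum>v\<in>nb E u. f u v) = (\<Sum>u\<in>V. \<Sum>v\<in>nb E u. f v u)"
proof -
  have "(\<Sum>(u, v)\<in>E. f u v) = (\<Sum>(u, v)\<in>E. f v u)"
    by (rule sum.reindex_bij_witness[of _ prod.swap prod.swap]) (auto intro: E_sym)
  then show ?thesis by (simp add: sum_arcs)
qed

lemma cod_as_sum: "cod E u v = (\<Sum>w\<in>V. if (w, u) \<in> E \<and> (w, v) \<in> E then 1 else 0)"
proof -
  have "nb E u \<inter> nb E v = {w \<in> V. (w, u) \<in> E \<and> (w, v) \<in> E}"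
    using in_V by (auto simp: E_commute)
  then show ?thesis unfolding cod_def by (simp add: sum.inter_filter[symmetric])
qed

lemma sum_cod: "(\<Sum>u\<in>V. \<Sum>v\<in>V. cod E u v) = (\<Sum>w\<in>V. (deg E w)\<^sup>2)"
proof -
  have "(\<Sum>u\<in>V. \<Sum>v\<in>V. cod E u v) = (\<Sum>u\<in>V. \<Sum>w\<in>V. \<Sum>v\<in>V. if (w, u) \<in> E \<and> (w, v) \<in> E then 1 else 0)"
    unfolding cod_as_sum by (intro sum.cong refl sum.swap)
  also have "\<dots> = (\<Sum>w\<in>V. \<Sum>u\<in>V. \<Sum>v\<in>V. if (w, u) \<in> E \<and> (w, v) \<in> E then 1 else 0)"
    by (rule sum.swap)
  also have "\<dots> = (\<Sum>w\<in>V. (deg E w)\<^sup>2)"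
  proof (intro sum.cong refl)
    fix w
    have d: "(\<Sum>v\<in>V. if (w, v) \<in> E then 1 else 0) = deg E w"
      using nb_sub[of w] by (auto simp: deg_def sum.inter_filter[symmetric] intro!: arg_cong[of _ _ card])
    have "(\<Sum>u\<in>V. \<Sum>v\<in>V. if (w, u) \<in> E \<and> (w, v) \<in> E then 1 else 0 :: nat)
        = (\<Sum>u\<in>V. \<Sum>v\<in>V. (if (w, u) \<in> E then 1 else 0) * (if (w, v) \<in> E then 1 else 0))"
      by (intro sum.cong refl) auto
    also have "\<dots> = (deg E w)\<^sup>2"
      by (simp add: sum_product[symmetric] d power2_eq_square del: mult_1_left mult_1_right)
    finally show "(\<Sum>u\<in>V. \<Sum>v\<in>V. if (w, u) \<in> E \<and> (w, v) \<in> E then 1 else 0 :: nat) = (deg E w)\<^sup>2" .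
  qed
  finally show ?thesis .
qed

text \<open>The arcs at \<open>u\<close> and the arcs at \<open>v\<close> overlap at most in the two
  arcs between \<open>u\<close> and \<open>v\<close>.\<close>

lemma deg_add_le:
  assumes "u \<noteq> v" shows "2 * (deg E u + deg E v) \<le> card E + 2"
proof -
  define A where "A x = {x} \<times> nb E x \<union> nb E x \<times> {x}" for x
  have cA: "card (A x) = 2 * deg E x" for x
    unfolding A_def deg_def by (subst card_Un_disjoint) (auto simp: card_cartesian_product)
  have fin: "finite (A x)" for x unfolding A_def by auto
  have "A u \<inter> A v \<subseteq> {(u, v), (v, u)}" using assms unfolding A_def by auto
  then have "card (A u \<inter> A v) \<le> card {(u, v), (v, u)}" by (rule card_mono[rotated]) simp
  then have "card (A u \<inter> A v) \<le> 2" by (simp add: card_insert_if split: if_splits)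
  moreover have "card (A u \<union> A v) \<le> card E"
    by (rule card_mono) (auto simp: A_def E_commute)
  moreover have "card (A u) + card (A v) = card (A u \<union> A v) + card (A u \<inter> A v)"
    by (rule card_Un_Int) (auto simp: fin)
  ultimately show ?thesis using cA by simp
qed

lemma walks4_split:
  "walks4 V E = (\<Sum>u\<in>V. (deg E u)\<^sup>2) + (\<Sum>u\<in>V. \<Sum>v\<in>V - {u}. (cod E u v)\<^sup>2)"
  unfolding walks4_def by (subst sum.distrib[symmetric]) (auto intro!: sum.cong simp: sum.remove)

lemma sum_cod_off:
  "(\<Sum>u\<in>V. deg E u) + (\<Sum>u\<in>V. \<Sum>v\<in>V - {u}. cod E u v) = (\<Sum>u\<in>V. (deg E u)\<^sup>2)"
  unfolding sum_cod[symmetric] by (subst sum.distrib[symmetric]) (auto intro!: sum.cong simp: sum.remove)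

lemma sum_excess:
  assumes "card E = 2 * card V + 4"
  shows "(\<Sum>u\<in>V. int (deg E u) - 2) = 4"
  using assms arg_cong[OF sum_deg, of int] by (simp add: sum_subtractf)

text \<open>Degrees are centred at 2 because the excesses then sum to 4 whatever the order. Off the
  diagonal, c^2 = 2 c + c (c - 2): the linear part is determined by the degrees, and the remainder
  is positive only for pairs with at least three common neighbours.\<close>

lemma walks4_excess:
  assumes "card E = 2 * card V + 4"
  shows "int (walks4 V E) = 8 * int (card V) + 40 + 3 * (\<Sum>u\<in>V. (int (deg E u) - 2)\<^sup>2)
    + (\<Sum>u\<in>V. \<Sum>v\<in>V - {u}. int (cod E u v) * (int (cod E u v) - 2))"
proof -
  let ?e = "\<lambda>u. int (deg E u) - 2"
  have "(\<Sum>u\<in>V. (int (deg E u))\<^sup>2) = (\<Sum>u\<in>V. 4 + 4 * ?e u + (?e u)\<^sup>2)"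
    by (intro sum.cong refl) (simp add: power2_eq_square algebra_simps)
  also have "\<dots> = 4 * int (card V) + 16 + (\<Sum>u\<in>V. (?e u)\<^sup>2)"
    by (simp only: sum.distrib sum_distrib_left[symmetric] sum_excess[OF assms]) simp
  finally have sq: "(\<Sum>u\<in>V. (int (deg E u))\<^sup>2) = 4 * int (card V) + 16 + (\<Sum>u\<in>V. (?e u)\<^sup>2)" .
  have off: "int (card E) + (\<Sum>u\<in>V. \<Sum>v\<in>V - {u}. int (cod E u v)) = (\<Sum>u\<in>V. (int (deg E u))\<^sup>2)"
    using arg_cong[OF sum_cod_off, of int] by (simp add: sum_deg)
  have "(\<Sum>u\<in>V. \<Sum>v\<in>V - {u}. (int (cod E u v))\<^sup>2)
    = (\<Sum>u\<in>V. \<Sum>v\<in>V - {u}. 2 * int (cod E u v) + int (cod E u v) * (int (cod E u v) - 2))"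
    by (intro sum.cong refl) (simp add: power2_eq_square algebra_simps)
  also have "\<dots> = 2 * (\<Sum>u\<in>V. \<Sum>v\<in>V - {u}. int (cod E u v))
      + (\<Sum>u\<in>V. \<Sum>v\<in>V - {u}. int (cod E u v) * (int (cod E u v) - 2))"
    by (simp only: sum.distrib sum_distrib_left)
  finally show ?thesis
    using sq off assms arg_cong[OF walks4_split, of int] by simp
qed

lemma sum_off_diag:
  fixes f :: "'a \<Rightarrow> int"
  shows "(\<Sum>u\<in>V. \<Sum>v\<in>V - {u}. f u * f v) = (sum f V)\<^sup>2 - (\<Sum>u\<in>V. (f u)\<^sup>2)"
proof -
  have "(sum f V)\<^sup>2 = (\<Sum>u\<in>V. \<Sum>v\<in>V. f u * f v)"
    by (simp add: power2_eq_square sum_product)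
  also have "\<dots> = (\<Sum>u\<in>V. (f u)\<^sup>2 + (\<Sum>v\<in>V - {u}. f u * f v))"
    by (intro sum.cong refl) (simp add: sum.remove power2_eq_square)
  finally show ?thesis by (simp add: sum.distrib)
qed

text \<open>When all excesses e are nonnegative, the remainder c (c - 2) of a pair is at most 3 e_u
  e_v. Summed over pairs this is 3 (16 - \<Sum>e^2), whose squares cancel those of
  \<open>walks4_excess\<close>, leaving 40 + 48 = 88.\<close>

lemma walks4_min_deg2:
  assumes E: "card E = 2 * card V + 4" and d: "\<And>u. u \<in> V \<Longrightarrow> 2 \<le> deg E u"
  shows "walks4 V E \<le> 8 * card V + 88"
proof -
  let ?e = "\<lambda>u. int (deg E u) - 2"
  have "int (cod E u v) * (int (cod E u v) - 2) \<le> 3 * (?e u * ?e v)" if "u \<in> V" "v \<in> V" for u v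
  proof (cases "cod E u v \<le> 2")
    case True
    then have "int (cod E u v) * (int (cod E u v) - 2) \<le> 0" by (simp add: mult_nonneg_nonpos)
    also have "0 \<le> 3 * (?e u * ?e v)" using d that by force
    finally show ?thesis .
  next
    case False
    define k where "k = int (cod E u v) - 2"
    have k: "1 \<le> k" "k \<le> ?e u" "k \<le> ?e v" using False cod_le[of u v] unfolding k_def by auto
    \<comment> \<open>Here c = k + 2, and k + 2 \<le> 3 k because k \<ge> 1; this is where the
      factor 3 comes from.\<close>
    have "(k + 2) * k \<le> 3 * k * k" using k by (intro mult_right_mono) auto
    also have "\<dots> \<le> 3 * (?e u * ?e v)" using k mult_mono[of k "?e u" k "?e v"] by simp
    finally show ?thesis unfolding k_def by simp
  qed
  then have "(\<Sum>u\<in>V. \<Sum>v\<in>V - {u}. int (cod E u v) * (int (cod E u v) - 2))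
      \<le> (\<Sum>u\<in>V. \<Sum>v\<in>V - {u}. 3 * (?e u * ?e v))"
    by (intro sum_mono) auto
  also have "\<dots> = 3 * (16 - (\<Sum>u\<in>V. (?e u)\<^sup>2))"
    using sum_off_diag[of ?e] sum_excess[OF E] by (simp only: sum_distrib_left[symmetric]) simp
  finally show ?thesis using walks4_excess[OF E] by simp
qed

end

section \<open>Deletion of a pendant vertex\<close>

locale pendant = sgraph +
  fixes u v :: 'a
  assumes nb_v: "nb E v = {u}"
begin

definition "V' = V - {v}"
definition "E' = E - {(u, v), (v, u)}"

lemma vu: "(v, u) \<in> E" "(u, v) \<in> E" "u \<noteq> v" "u \<in> V" "v \<in> V" "u \<in> V'"
proof -
  show "(v, u) \<in> E" using nb_v in_nb by fastforce
  then show "(u, v) \<in> E" "u \<noteq> v" "u \<in> V" "v \<in> V" "u \<in> V'"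
    using E_sym in_V unfolding V'_def by auto
qed

lemma adj_v: "(v, x) \<in> E \<longleftrightarrow> x = u" "(x, v) \<in> E \<longleftrightarrow> x = u"
  using nb_v E_commute in_nb by fastforce+

lemma sgraph': "sgraph V' E'"
proof
  show "E' \<subseteq> V' \<times> V'" using E_sub adj_v unfolding V'_def E'_def by auto
qed (auto simp: V'_def E'_def E_sym)

lemma card_V': "card V = Suc (card V')"
  using vu card_Suc_Diff1[OF finite_V] unfolding V'_def by simp

lemma card_E': "card E = card E' + 2"
proof -
  have "card E' = card E - card {(u, v), (v, u)}"
    unfolding E'_def using vu by (intro card_Diff_subset) auto
  moreover have "card {(u, v), (v, u)} = 2" using vu by simp
  moreover have "card {(u, v), (v, u)} \<le> card E" using vu by (intro card_mono) auto
  ultimately show ?thesis by simp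
qed

lemma nb': "x \<in> V' \<Longrightarrow> nb E x = (if x = u then insert v (nb E' x) else nb E' x)"
  using adj_v vu unfolding E'_def V'_def nb_def by auto

lemma v_notin_nb': "v \<notin> nb E' x"
  using adj_v unfolding E'_def by auto

lemma deg_u: "deg E u = Suc (deg E' u)"
  using sgraph.finite_nb[OF sgraph'] v_notin_nb' vu by (simp add: deg_def nb')

lemma cod': "x \<in> V' \<Longrightarrow> y \<in> V' \<Longrightarrow> cod E x y = (if x = u \<and> y = u then Suc (cod E' x y) else cod E' x y)"
  using v_notin_nb' sgraph.finite_nb[OF sgraph'] by (auto simp: cod_def nb' deg_def)

lemma cod_v: "cod E v x = (if (u, x) \<in> E then 1 else 0)"
  by (simp add: cod_def nb_v E_commute)

text \<open>Let d be the degree of \<open>u\<close> after the deletion. The row of \<open>v\<close>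
  contributes 1 + d, the column of \<open>v\<close> another d, and the diagonal entry at
  \<open>u\<close> changes from d^2 to (d + 1)^2; the total is 4 d + 2.\<close>

lemma walks4': "walks4 V E + 2 = walks4 V' E' + 4 * deg E u"
proof -
  interpret G': sgraph V' E' by (rule sgraph')
  have V: "sum f V = f v + sum f V'" for f :: "'a \<Rightarrow> nat"
    unfolding V'_def using finite_V vu(5) by (rule sum.remove)
  have a: "(\<Sum>x\<in>V'. (cod E v x)\<^sup>2) = deg E' u"
  proof -
    have "(\<Sum>x\<in>V'. (cod E v x)\<^sup>2) = (\<Sum>x\<in>V'. if (u, x) \<in> E then 1 else 0)"
      by (intro sum.cong) (auto simp: cod_v)
    also have "\<dots> = card {x \<in> V'. (u, x) \<in> E}"
      by (simp add: sum.inter_filter[symmetric])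
    also have "{x \<in> V'. (u, x) \<in> E} = nb E' u"
      using in_V vu unfolding V'_def E'_def by auto
    finally show ?thesis by (simp add: deg_def)
  qed
  have "(\<Sum>x\<in>V'. \<Sum>y\<in>V'. (cod E x y)\<^sup>2)
    = (\<Sum>x\<in>V'. \<Sum>y\<in>V'. (cod E' x y)\<^sup>2 + (if x = u then if y = u then 2 * deg E' u + 1 else 0 else 0))"
    by (intro sum.cong refl) (auto simp: cod' power2_eq_square)
  also have "\<dots> = walks4 V' E' + (\<Sum>x\<in>V'. if x = u then 2 * deg E' u + 1 else 0)"
  proof -
    have "(\<Sum>y\<in>V'. if x = u then if y = u then k else 0 else 0) = (if x = u then k else 0)" for x and k :: nat
      using vu by (cases "x = u") auto
    then show ?thesis by (simp only: sum.distrib walks4_def)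
  qed
  also have "\<dots> = walks4 V' E' + (2 * deg E' u + 1)"
    using vu by simp
  finally have b: "(\<Sum>x\<in>V'. \<Sum>y\<in>V'. (cod E x y)\<^sup>2) = walks4 V' E' + (2 * deg E' u + 1)" .
  have "deg E v = 1" by (simp add: deg_def nb_v)
  then have "walks4 V E = 1 + deg E' u + (deg E' u + (walks4 V' E' + (2 * deg E' u + 1)))"
    using a b by (simp add: walks4_def V sum.distrib cod_commute[of E _ v])
  then show ?thesis by (simp add: deg_u)
qed

text \<open>Divided by 8: b_4 is the number of 2-matchings minus twice the number of four-cycles. A
  pendant edge lies on no cycle, so b_4 grows by the number of edges disjoint from it, which is m -
  \<open>deg E u\<close>.\<close>

lemma quad': "quad V E = quad V' E' + 4 * int (card E) - 8 * int (deg E u)"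
proof -
  have "2 * int (walks4 V E) + 4 = 2 * int (walks4 V' E') + 8 * int (deg E u)"
    using walks4' by linarith
  then show ?thesis
    unfolding quad_def card_E' by (simp add: power2_eq_square algebra_simps)
qed

text \<open>A cut of the smaller graph is lifted by putting \<open>v\<close> on the side of
  \<open>u\<close>; the arc that crosses the lifted cut then avoids \<open>v\<close>.\<close>

lemma no_cut':
  assumes "no_cut V E" shows "no_cut V' E'"
  unfolding no_cut_def
proof (intro allI impI)
  fix S assume S: "S \<subseteq> V' \<and> S \<noteq> {} \<and> S \<noteq> V'"
  define T where "T = (if u \<in> S then insert v S else S)"
  have "T \<subseteq> V" "T \<noteq> {}" "T \<noteq> V" using S vu unfolding V'_def T_def by (auto split: if_splits)
  then obtain x y where xy: "x \<in> T" "y \<in> V" "y \<notin> T" "(x, y) \<in> E"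
    using assms unfolding no_cut_def by (metis Diff_iff)
  have uv: "u \<in> T \<longleftrightarrow> v \<in> T" using S vu unfolding V'_def T_def by auto
  have "x \<noteq> v" using xy uv adj_v by auto
  moreover have "y \<noteq> v" using xy uv adj_v by auto
  ultimately have "x \<in> S" "y \<in> V' - S" "(x, y) \<in> E'"
    using xy unfolding E'_def V'_def T_def by (auto split: if_splits)
  then show "\<exists>x\<in>S. \<exists>y\<in>V' - S. (x, y) \<in> E'" by blast
qed

end

text \<open>S is \<open>is_hub _ _ True 3\<close> and B is \<open>is_hub _ _ False 4\<close>.\<close>

definition hub_arcs :: "'a set \<Rightarrow> 'a \<Rightarrow> 'a \<Rightarrow> 'a set \<Rightarrow> bool \<Rightarrow> 'a rel" where
  "hub_arcs V a b X J =
    {(u, v). u \<in> V \<and> v \<in> V \<and> u \<noteq> v \<and>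
      (u = a \<and> v \<noteq> b \<or> v = a \<and> u \<noteq> b \<or> u = b \<and> v \<in> X \<or> v = b \<and> u \<in> X \<or> J \<and> {u, v} = {a, b})}"

definition is_hub :: "'a set \<Rightarrow> 'a rel \<Rightarrow> bool \<Rightarrow> nat \<Rightarrow> bool" where
  "is_hub V E J k \<longleftrightarrow>
    (\<exists>a b X. a \<in> V \<and> b \<in> V \<and> a \<noteq> b \<and> X \<subseteq> V - {a, b} \<and> card X = k \<and> E = hub_arcs V a b X J)"

section \<open>Graphs with a dominating vertex\<close>

locale coned = sgraph +
  fixes z :: 'a
  assumes z [simp]: "z \<in> V" and dom: "v \<in> V - {z} \<Longrightarrow> (z, v) \<in> E" and card_E: "card E = 2 * card V + 4"
begin

definition "W = V - {z}"
definition "H = E \<inter> W \<times> W"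

sublocale H: sgraph W H
  by unfold_locales (auto simp: W_def H_def E_sym)

lemma V_eq: "x \<in> V \<longleftrightarrow> x = z \<or> x \<in> W" "z \<notin> W"
  using z unfolding W_def by auto

lemma card_V: "card V = Suc (card W)"
  using card_Suc_Diff1[OF finite_V z] unfolding W_def by simp

lemma sum_V: "sum f V = f z + sum f W" for f :: "'a \<Rightarrow> nat"
  unfolding W_def using finite_V z by (rule sum.remove)

lemma dom': "v \<in> W \<Longrightarrow> (z, v) \<in> E" "v \<in> W \<Longrightarrow> (v, z) \<in> E"
  using dom E_sym unfolding W_def by auto

text \<open>Of the n + 2 edges, n - 1 meet the dominating vertex, so exactly three edges remain. All
  estimates for this case are about graphs with three edges.\<close>

lemma card_H: "card H = 6"
proof -
  have "E = H \<union> ({z} \<times> W \<union> W \<times> {z})"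
    using E_sub dom' unfolding H_def W_def by auto
  moreover have "card (H \<union> ({z} \<times> W \<union> W \<times> {z})) = card H + (card W + card W)"
    using V_eq by (subst card_Un_disjoint, (auto simp: H_def)[3], subst card_Un_disjoint)
      (auto simp: card_cartesian_product)
  ultimately show ?thesis using card_E card_V by simp
qed

lemma nb_z: "nb E z = W"
  using nb_sub(2)[of z] dom'(1) unfolding W_def by (meson in_nb subsetI subset_antisym)

lemma nb_W: "u \<in> W \<Longrightarrow> nb E u = insert z (nb H u)" "z \<notin> nb H u"
  using dom' E_sub unfolding H_def W_def by auto

lemma deg_z: "deg E z = card W"
  by (simp add: deg_def nb_z)

lemma cod_W: "u \<in> W \<Longrightarrow> v \<in> W \<Longrightarrow> cod E u v = Suc (cod H u v)"
  using nb_W by (simp add: cod_def)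

lemma cod_z: "v \<in> W \<Longrightarrow> cod E z v = deg H v" "v \<in> W \<Longrightarrow> cod E v z = deg H v"
proof -
  assume v: "v \<in> W"
  have "W \<inter> insert z (nb H v) = nb H v" using H.nb_sub[of v] V_eq by auto
  then show "cod E z v = deg H v" by (simp add: cod_def deg_def nb_z nb_W v)
  then show "cod E v z = deg H v" by (simp add: cod_commute)
qed

lemma few_arcs: "A \<subseteq> H \<Longrightarrow> card A \<le> 6"
  using card_mono[of H A] card_H by simp

text \<open>Two common neighbours would give a four-cycle, which has one edge too many.\<close>

lemma cod_H: assumes "u \<noteq> v" shows "cod H u v \<le> 1"
proof (rule ccontr)
  assume "\<not> cod H u v \<le> 1"
  then have "2 \<le> card (nb H u \<inter> nb H v)" by (simp add: cod_def)
  then obtain x y where xy: "x \<noteq> y" "x \<in> nb H u \<inter> nb H v" "y \<in> nb H u \<inter> nb H v"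
    by (meson card_2_iff' obtain_subset_with_card_n subsetD)
  have ne: "x \<noteq> u" "x \<noteq> v" "y \<noteq> u" "y \<noteq> v" using xy H.E_irr by auto
  let ?A = "{(u, x), (x, u), (u, y), (y, u), (v, x), (x, v), (v, y), (y, v)}"
  have "card ?A = 8" using xy(1) ne assms by simp
  moreover have "?A \<subseteq> H" using xy H.E_sym by auto
  ultimately show False using few_arcs[of ?A] by simp
qed

definition "S2 = (\<Sum>u\<in>W. (deg H u)\<^sup>2)"

text \<open>Any two vertices of \<open>W\<close> gain \<open>z\<close> as a common neighbour. Since
  codegrees of distinct vertices in \<open>H\<close> are 0 or 1, they equal their squares, and
  everything reduces to the degrees in \<open>H\<close>.\<close>

lemma walks4_cone: "walks4 V E + 6 = 2 * (card W)\<^sup>2 + 6 * S2"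
proof -
  have off: "(\<Sum>u\<in>W. \<Sum>v\<in>W - {u}. (cod H u v)\<^sup>2) + 6 = S2"
  proof -
    have sq: "(cod H u v)\<^sup>2 = cod H u v" if "v \<in> W - {u}" for u v
    proof -
      have "cod H u v = 0 \<or> cod H u v = 1" using cod_H[of u v] that by auto
      then show ?thesis by auto
    qed
    have "(\<Sum>u\<in>W. \<Sum>v\<in>W - {u}. (cod H u v)\<^sup>2) = (\<Sum>u\<in>W. \<Sum>v\<in>W - {u}. cod H u v)"
      by (intro sum.cong refl sq)
    then show ?thesis using H.sum_cod_off H.sum_deg card_H by (simp add: S2_def)
  qed
  have "(\<Sum>u\<in>W. \<Sum>v\<in>W. (cod E u v)\<^sup>2) = (\<Sum>u\<in>W. \<Sum>v\<in>W. 1 + 2 * cod H u v + (cod H u v)\<^sup>2)"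
    by (intro sum.cong refl) (simp add: cod_W power2_eq_square)
  also have "\<dots> = (card W)\<^sup>2 + 2 * S2 + walks4 W H"
    unfolding S2_def H.sum_cod[symmetric] walks4_def
    by (simp only: sum.distrib sum_distrib_left) (simp add: power2_eq_square)
  finally have "(\<Sum>u\<in>W. \<Sum>v\<in>W. (cod E u v)\<^sup>2) + 6 = (card W)\<^sup>2 + 4 * S2"
    using H.walks4_split off by (simp add: S2_def)
  moreover have "walks4 V E = (card W)\<^sup>2 + S2 + (S2 + (\<Sum>u\<in>W. \<Sum>v\<in>W. (cod E u v)\<^sup>2))"
    by (simp add: walks4_def sum_V sum.distrib cod_z deg_z S2_def)
  ultimately show ?thesis by simp
qed

lemma quad_cone: "quad V E = 24 * int (card V) + 24 - 12 * int S2"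
proof -
  have "int (walks4 V E) + 6 = 2 * (int (card W))\<^sup>2 + 6 * int S2"
    using arg_cong[OF walks4_cone, of int] by simp
  moreover have "int (card E) = 2 * int (card W) + 6" using card_E card_V by simp
  ultimately show ?thesis
    unfolding quad_def using card_V by (simp add: power2_eq_square algebra_simps)
qed

lemma S2_arcs: "2 * S2 = (\<Sum>(u, v)\<in>H. deg H u + deg H v)"
proof -
  have "(\<Sum>u\<in>W. \<Sum>v\<in>nb H u. deg H u) = S2" by (simp add: S2_def deg_def power2_eq_square)
  then show ?thesis
    using H.sum_swap_nb[of "\<lambda>u v. deg H u"] by (simp add: H.sum_arcs sum.distrib)
qed

lemma deg_H_add: "(u, v) \<in> H \<Longrightarrow> deg H u + deg H v \<le> 4"
  using H.deg_add_le[of u v] card_H H.E_irr by (cases "u = v") auto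

text \<open>Summing \<open>deg H u + deg H v\<close> over the arcs counts every square twice, and
  each of the six summands is at most 4. Both a star and a triangle attain the bound, so equality
  here does not yet determine the graph.\<close>

lemma S2_le: "S2 \<le> 12"
proof -
  have "2 * S2 \<le> (\<Sum>e\<in>H. 4)"
    unfolding S2_arcs by (intro sum_mono) (auto dest: deg_H_add)
  then show ?thesis using card_H by simp
qed

lemma quad_cone_ge: "quad V E \<ge> 24 * (int (card V) - 5)"
  using quad_cone of_nat_mono[OF S2_le] by simp

text \<open>Each of the three edges of \<open>H\<close> forms a triangle with \<open>z\<close>, and
  a triangle is counted six times.\<close>

lemma walks3_cone: "walks3 E = 18 + walks3 H"
proof -
  have "walks3 E = (\<Sum>u\<in>V. \<Sum>v\<in>nb E u. cod E u v)"
    by (simp add: walks3_def sum_arcs)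
  also have "\<dots> = (\<Sum>v\<in>W. deg H v) + (\<Sum>u\<in>W. \<Sum>v\<in>insert z (nb H u). cod E u v)"
    by (simp add: sum_V nb_z cod_z nb_W)
  also have "(\<Sum>u\<in>W. \<Sum>v\<in>insert z (nb H u). cod E u v)
      = (\<Sum>u\<in>W. deg H u + (deg H u + (\<Sum>v\<in>nb H u. cod H u v)))"
  proof (intro sum.cong refl)
    fix u assume u: "u \<in> W"
    have "(\<Sum>v\<in>nb H u. cod E u v) = (\<Sum>v\<in>nb H u. 1 + cod H u v)"
      using u H.in_V by (intro sum.cong refl) (auto simp: cod_W)
    then show "(\<Sum>v\<in>insert z (nb H u). cod E u v) = deg H u + (deg H u + (\<Sum>v\<in>nb H u. cod H u v))"
      using u nb_W(2) H.finite_nb by (simp add: cod_z sum.distrib sum_Suc deg_def)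
  qed
  finally show ?thesis
    by (simp add: sum.distrib H.sum_deg card_H walks3_def H.sum_arcs)
qed

text \<open>The condition on \<open>walks3 H\<close> rules out the triangle. If no degree reached 3,
  the equality in \<open>S2_le\<close> would force both ends of every edge to have degree 2, and
  extending a path of two edges at both of its ends would produce a fourth edge.\<close>

lemma exists_deg3:
  assumes "S2 = 12" "walks3 H = 0" shows "\<exists>b\<in>W. 3 \<le> deg H b"
proof (rule ccontr)
  assume no: "\<not> (\<exists>b\<in>W. 3 \<le> deg H b)"
  have deg4: "deg H u + deg H v = 4" if "(u, v) \<in> H" for u v
  proof -
    have "(\<Sum>(u, v)\<in>H. deg H u + deg H v) = (\<Sum>(u, v)\<in>H. 4)"
      using assms(1) S2_arcs card_H by (simp add: case_prod_unfold)
    then show ?thesis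
      using sum_mono_inv[of "\<lambda>(u, v). deg H u + deg H v" H "\<lambda>_. 4" "(u, v)"] deg_H_add that
      by (auto simp: case_prod_unfold)
  qed
  have deg2: "deg H u = 2" if "(u, v) \<in> H" for u v
  proof -
    have "\<not> 3 \<le> deg H u" "\<not> 3 \<le> deg H v" using no H.in_V[OF that] by blast+
    then show ?thesis using deg4[OF that] by linarith
  qed
  have other: "\<exists>w. w \<noteq> v \<and> (u, w) \<in> H" if "(u, v) \<in> H" for u v
  proof (rule ccontr)
    assume "\<nexists>w. w \<noteq> v \<and> (u, w) \<in> H"
    then have "nb H u \<subseteq> {v}" by auto
    then have "deg H u \<le> 1" unfolding deg_def using card_mono[of "{v}" "nb H u"] by simp
    then show False using deg2[OF that] by simp
  qed
  have "H \<noteq> {}" using card_H by auto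
  then obtain u v where uv: "(u, v) \<in> H" by auto
  obtain w where w: "w \<noteq> v" "(u, w) \<in> H" using other[OF uv] by blast
  have "cod H u v = 0"
    using assms(2) uv H.finite_E unfolding walks3_def by (auto simp: sum_eq_0_iff)
  then have vw: "(v, w) \<notin> H" using w H.finite_nb by (auto simp: cod_def)
  obtain x where x: "x \<noteq> u" "(v, x) \<in> H" using other H.E_sym[OF uv] by blast
  obtain y where y: "y \<noteq> u" "(w, y) \<in> H" using other H.E_sym[OF w(2)] by blast
  \<comment> \<open>Four edges in both directions; they are distinct even if \<open>x\<close> and
    \<open>y\<close> coincide.\<close>
  let ?A = "{(u, v), (v, u), (u, w), (w, u), (v, x), (x, v), (w, y), (y, w)}"
  have "u \<noteq> v" "u \<noteq> w" "x \<noteq> v" "y \<noteq> w" "x \<noteq> w" "y \<noteq> v"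
    using uv w x y vw H.E_sym H.E_irr by auto
  then have "card ?A = 8" using w(1) x(1) y(1) by simp
  moreover have "?A \<subseteq> H" using uv w x y H.E_sym by auto
  ultimately show False using few_arcs[of ?A] by simp
qed

text \<open>Equality in both bounds makes \<open>H\<close> a star with three leaves; its centre
  \<open>b\<close> and the dominating vertex \<open>z\<close> are the two hubs.\<close>

lemma cone_equality:
  assumes "quad V E = 24 * (int (card V) - 5)" "walks3 E = 18"
  shows "is_hub V E True 3"
proof -
  have "S2 = 12" using assms(1) quad_cone by simp
  moreover have "walks3 H = 0" using assms(2) walks3_cone by simp
  ultimately obtain b where b: "b \<in> W" "3 \<le> deg H b" using exists_deg3 by blast
  let ?A = "{b} \<times> nb H b \<union> nb H b \<times> {b}"
  have "card ?A = 2 * deg H b"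
    using H.finite_nb by (subst card_Un_disjoint) (auto simp: deg_def card_cartesian_product)
  moreover have A: "?A \<subseteq> H" using H.E_sym by auto
  ultimately have "deg H b = 3" "card ?A = card H" using few_arcs[OF A] b card_H by auto
  then have H_eq: "H = ?A" using A H.finite_E card_subset_eq by metis
  have "E = hub_arcs V z b (nb H b) True"
  proof (intro subset_antisym subrelI)
    fix u v assume "(u, v) \<in> E"
    moreover from this have "(u, v) \<in> H \<or> u = z \<or> v = z" "u \<in> V" "v \<in> V" "u \<noteq> v"
      using in_V unfolding H_def W_def by auto
    ultimately show "(u, v) \<in> hub_arcs V z b (nb H b) True"
      using H_eq unfolding hub_arcs_def by auto
  next
    fix u v assume "(u, v) \<in> hub_arcs V z b (nb H b) True"
    then consider "u = z" "v \<in> W" | "v = z" "u \<in> W" | "u = b" "v \<in> nb H b" | "v = b" "u \<in> nb H b"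
      using b V_eq unfolding hub_arcs_def by (auto simp: doubleton_eq_iff)
    then show "(u, v) \<in> E"
      using dom' H.E_sym unfolding H_def by cases auto
  qed
  moreover have "nb H b \<subseteq> V - {z, b}" using H.nb_sub[of b] V_eq by auto
  ultimately show ?thesis
    unfolding is_hub_def using b V_eq \<open>deg H b = 3\<close>
    by (intro exI[of _ z] exI[of _ b] exI[of _ "nb H b"]) (auto simp: deg_def)
qed

end

section \<open>Small orders and induction on pendant vertices\<close>

context sgraph
begin

lemma sum_nb: "(\<Sum>v\<in>nb E u. f v) = (\<Sum>v\<in>V. if (u, v) \<in> E then f v else 0)"
proof -
  have "nb E u = {v \<in> V. (u, v) \<in> E}" using in_V by auto
  then show ?thesis by (simp add: sum.inter_filter)
qed

lemma deg_pos:
  assumes "no_cut V E" "u \<in> V" "2 \<le> card V" shows "1 \<le> deg E u"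
proof -
  have "{u} \<noteq> V" using assms(3) by auto
  then obtain v where "(u, v) \<in> E"
    using assms(1,2) unfolding no_cut_def by (metis empty_subsetI insert_not_empty insert_subset singletonD)
  then have "nb E u \<noteq> {}" by auto
  then show ?thesis unfolding deg_def by (simp add: Suc_leI card_gt_0_iff)
qed

lemma pendant_if_deg1: "deg E v = 1 \<Longrightarrow> \<exists>u. pendant V E u v"
  unfolding deg_def by (metis card_1_singletonE pendant.intro pendant_axioms.intro sgraph_axioms)

lemma deg_not_cone:
  assumes "\<not> cone V E" "u \<in> V" shows "deg E u + 2 \<le> card V"
proof (rule ccontr)
  assume "\<not> deg E u + 2 \<le> card V"
  then have "card (V - {u}) \<le> card (nb E u)" using assms(2) by (simp add: deg_def)
  then have "nb E u = V - {u}" using nb_sub(2)[of u] finite_V by (meson card_seteq finite_Diff)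
  then have "cone V E" unfolding cone_def using assms(2) by (metis in_nb)
  then show False using assms by blast
qed

lemma coned_if_cone: "cone V E \<Longrightarrow> card E = 2 * card V + 4 \<Longrightarrow> \<exists>z. coned V E z"
  unfolding cone_def by (metis coned.intro coned_axioms.intro sgraph_axioms)

lemma nb_eqI:
  assumes "A \<subseteq> nb E u" "deg E u \<le> card A" shows "nb E u = A"
  using assms card_seteq[OF finite_nb] unfolding deg_def by metis

lemma nb_eqI':
  assumes "nb E u \<subseteq> A" "finite A" "card A \<le> deg E u" shows "nb E u = A"
  using assms card_seteq unfolding deg_def by metis

text \<open>All degrees are at most 3 and sum to 14, so they are 3, 3, 3, 3, 2. This leaves a single
  graph, whose complement is the path a - b - c together with the edge d - e, and its invariants are
  computed outright.\<close>

lemma quad_order5: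
  assumes n: "card V = 5" and E: "card E = 14" and nc: "\<not> cone V E"
  shows "quad V E = 16"
proof -
  have d3: "deg E u \<le> 3" if "u \<in> V" for u using deg_not_cone[OF nc that] n by simp
  have "\<exists>b\<in>V. deg E b \<le> 2"
  proof (rule ccontr)
    assume "\<not> ?thesis"
    then have "\<forall>u\<in>V. 3 \<le> deg E u" by force
    then have "(\<Sum>u\<in>V. 3) \<le> (\<Sum>u\<in>V. deg E u)" by (intro sum_mono) auto
    then show False using sum_deg E n by simp
  qed
  then obtain b where b: "b \<in> V" "deg E b \<le> 2" by blast
  have s: "deg E b + (\<Sum>u\<in>V - {b}. deg E u) = 14"
    using sum.remove[OF finite_V b(1), of "deg E"] sum_deg E by simp
  have le12: "(\<Sum>u\<in>V - {b}. deg E u) \<le> (\<Sum>u\<in>V - {b}. 3)" using d3 by (intro sum_mono) auto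
  have "(\<Sum>u\<in>V - {b}. 3) = (12 :: nat)" using n b by simp
  then have b2: "deg E b = 2" and "(\<Sum>u\<in>V - {b}. deg E u) = (\<Sum>u\<in>V - {b}. 3)"
    using s le12 b by auto
  then have d: "deg E u = 3" if "u \<in> V" "u \<noteq> b" for u
    using sum_mono_inv[of "deg E" "V - {b}" "\<lambda>_. 3" u] d3 that by auto
  obtain d e where de: "nb E b = {d, e}" "d \<noteq> e" using b2 by (auto simp: deg_def card_2_iff)
  have inV: "d \<in> V" "e \<in> V" "d \<noteq> b" "e \<noteq> b" using de nb_sub(2)[of b] by auto
  then have "card (V - {b, d, e}) = 2"
    using n b de(2) by (subst card_Diff_subset) auto
  then obtain a c where ac: "V - {b, d, e} = {a, c}" "a \<noteq> c" by (auto simp: card_2_iff)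
  have V: "V = {a, b, c, d, e}" using ac(1) b inV by blast
  have ne: "a \<noteq> b" "a \<noteq> d" "a \<noteq> e" "c \<noteq> b" "c \<noteq> d" "c \<noteq> e" using ac(1) by blast+
  have bE: "(x, b) \<in> E \<longleftrightarrow> x = d \<or> x = e" for x
  proof -
    have "x \<in> nb E b \<longleftrightarrow> x = d \<or> x = e" using de(1) by simp
    then show ?thesis using E_commute[of x b] by simp
  qed
  \<comment> \<open>As \<open>b\<close> is adjacent to \<open>d\<close> and \<open>e\<close> only,
    \<open>a\<close> has just three possible neighbours, and its degree is 3.\<close>
  have a: "nb E a = {c, d, e}"
    by (rule nb_eqI') (use nb_sub(2)[of a] V bE[of a] ne ac(2) de(2) d[of a] in auto)
  have c: "nb E c = {a, d, e}"
    by (rule nb_eqI') (use nb_sub(2)[of c] V bE[of c] ne ac(2) de(2) d[of c] in auto)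
  have "(a, d) \<in> E" "(a, e) \<in> E" "(c, d) \<in> E" "(c, e) \<in> E" using a c by (simp_all flip: in_nb)
  then have E': "(d, a) \<in> E" "(e, a) \<in> E" "(d, c) \<in> E" "(e, c) \<in> E" by (auto intro: E_sym)
  have dd: "nb E d = {a, b, c}"
    by (rule nb_eqI) (use E' bE[of d] ne ac(2) d[of d] inV in auto)
  have ee: "nb E e = {a, b, c}"
    by (rule nb_eqI) (use E' bE[of e] ne ac(2) d[of e] inV in auto)
  note ne' = ne ne[symmetric] ac(2) ac(2)[symmetric] de(2) de(2)[symmetric] inV(3,4) inV(3,4)[symmetric]
  have "walks4 V E = 90"
    unfolding walks4_def cod_def V by (simp add: ne' a c dd ee de(1) power2_eq_square)
  then show ?thesis unfolding quad_def E by simp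
qed

text \<open>At this order \<open>walks4_min_deg2\<close> would only give \<open>quad V E\<close>
  \<ge> -16. Since degrees lie between 2 and 4 and the excesses sum to 4, there are three degree
  distributions, and in each the pairs with three common neighbours can be counted. The only
  exception to the bound is the complete bipartite graph with parts of size 2 and 4.\<close>

lemma order6_min_deg2:
  assumes n: "card V = 6" and E: "card E = 16" and nc: "\<not> cone V E"
    and d2: "\<And>u. u \<in> V \<Longrightarrow> 2 \<le> deg E u"
  shows "32 \<le> quad V E \<or> is_hub V E False 4"
proof (rule disjCI)
  assume not_hub: "\<not> is_hub V E False 4"
  have d4: "deg E u \<le> 4" if "u \<in> V" for u using deg_not_cone[OF nc that] n by simp
  define F where "F k = {u \<in> V. deg E u = k}" for k
  define P where "P = {(u, v). u \<in> V \<and> v \<in> V \<and> u \<noteq> v \<and> 3 \<le> cod E u v}"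
  have fin: "finite (F k)" "finite P" for k
    unfolding F_def P_def by (auto intro: finite_subset[of _ "V \<times> V"])
  have e: "int (deg E u) - 2 = (if u \<in> F 3 then 1 else 0) + (if u \<in> F 4 then 2 else 0)" if "u \<in> V" for u
    using d2[OF that] d4[OF that] that unfolding F_def by auto
  have sum_F: "(\<Sum>u\<in>V. if u \<in> F k then c else 0) = c * int (card (F k))" for k and c :: int
  proof -
    have "V \<inter> F k = F k" unfolding F_def by auto
    then show ?thesis by (simp add: sum.If_cases)
  qed
  have "(\<Sum>u\<in>V. int (deg E u) - 2) = (\<Sum>u\<in>V. (if u \<in> F 3 then 1 else 0) + (if u \<in> F 4 then 2 else 0))"
    by (intro sum.cong refl e)
  then have F34: "int (card (F 3)) + 2 * int (card (F 4)) = 4"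
    using sum_excess n E by (simp add: sum.distrib sum_F)
  have "(\<Sum>u\<in>V. (int (deg E u) - 2)\<^sup>2) = (\<Sum>u\<in>V. (if u \<in> F 3 then 1 else 0) + (if u \<in> F 4 then 4 else 0))"
    by (intro sum.cong refl) (auto simp: e F_def)
  then have sq: "(\<Sum>u\<in>V. (int (deg E u) - 2)\<^sup>2) = 4 + 2 * int (card (F 4))"
    using F34 by (simp add: sum.distrib sum_F)
  define R where "R = (\<Sum>u\<in>V. \<Sum>v\<in>V - {u}. int (cod E u v) * (int (cod E u v) - 2))"
  have w: "int (walks4 V E) = 100 + 6 * int (card (F 4)) + R"
    using walks4_excess n E sq unfolding R_def by simp
  have P_sym: "(v, u) \<in> P" if "(u, v) \<in> P" for u v
    using that unfolding P_def by (auto simp: cod_commute)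
  have P_deg: "3 \<le> deg E u" "3 \<le> deg E v" if "(u, v) \<in> P" for u v
    using that cod_le[of u v] unfolding P_def by auto
  have P_sub: "nb E u \<subseteq> nb E v" if "(u, v) \<in> P" "deg E u = 3" for u v
  proof -
    have "card (nb E u) \<le> card (nb E u \<inter> nb E v)" using that unfolding P_def cod_def deg_def by auto
    then have "nb E u \<inter> nb E v = nb E u" by (intro card_seteq) auto
    then show ?thesis by blast
  qed
  have R_le: "R \<le> 3 * int (card P)" if le3: "\<And>u v. (u, v) \<in> P \<Longrightarrow> cod E u v \<le> 3"
  proof -
    have "int (cod E u v) * (int (cod E u v) - 2) \<le> (if (u, v) \<in> P then 3 else 0)"
      if uv: "u \<in> V" "v \<in> V - {u}" for u v
    proof (cases "(u, v) \<in> P")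
      case True
      then have "cod E u v = 3" using le3[OF True] True unfolding P_def by auto
      then show ?thesis using True by simp
    next
      case False
      then have "int (cod E u v) \<le> 2" using uv unfolding P_def by auto
      then show ?thesis using False by (simp add: mult_nonneg_nonpos)
    qed
    then have "R \<le> (\<Sum>u\<in>V. \<Sum>v\<in>V - {u}. if (u, v) \<in> P then 3 else 0)"
      unfolding R_def by (intro sum_mono) auto
    also have "\<dots> = (\<Sum>u\<in>V. \<Sum>v\<in>V. if (u, v) \<in> P then 3 else 0)"
      by (intro sum.cong refl sum.mono_neutral_left) (auto simp: P_def)
    also have "\<dots> = (\<Sum>p\<in>V \<times> V. if p \<in> P then 3 else 0)"
      by (simp add: sum.cartesian_product case_prod_unfold)
    also have "\<dots> = 3 * int (card P)"
    proof -
      have "V \<times> V \<inter> P = P" unfolding P_def by auto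
      then show ?thesis by (simp add: sum.If_cases)
    qed
    finally show ?thesis .
  qed
  \<comment> \<open>With 16 arcs the claim amounts to \<open>walks4 V E\<close> \<le> 112, which by
    \<open>w\<close> is this bound.\<close>
  have "R + 6 * int (card (F 4)) \<le> 12"
  proof -
    consider "card (F 4) = 2" | "card (F 4) = 1" | "card (F 4) = 0" using F34 by linarith
    then show ?thesis
    proof cases
      case 1
      then obtain a b where ab: "F 4 = {a, b}" "a \<noteq> b" by (auto simp: card_2_iff)
      have "F 3 = {}" using 1 F34 fin by simp
      then have deg2: "deg E w = 2" if "w \<in> V" "w \<noteq> a" "w \<noteq> b" for w
        using d2[OF that(1)] d4[OF that(1)] that ab unfolding F_def by force
      have in_ab: "a \<in> V" "b \<in> V" "deg E a = 4" "deg E b = 4" using ab unfolding F_def by blast+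
      \<comment> \<open>The two vertices of degree 4 are the only candidates for a pair in
        \<open>P\<close>. If they are adjacent, three common neighbours use up all degrees and
        isolate the sixth vertex; if not, the graph is the exceptional one.\<close>
      have "(a, b) \<notin> P"
      proof
        assume "(a, b) \<in> P"
        then have c3: "3 \<le> cod E a b" unfolding P_def by auto
        define N where "N = nb E a \<inter> nb E b"
        have nbN: "nb E w = {a, b}" if "w \<in> N" for w
        proof -
          have "(a, w) \<in> E" "(b, w) \<in> E" using that unfolding N_def by auto
          then have "w \<in> V" "w \<noteq> a" "w \<noteq> b" "{a, b} \<subseteq> nb E w" using in_V E_sym by auto
          then show ?thesis using deg2 ab(2) by (intro nb_eqI) auto
        qed
        show False
        proof (cases "(a, b) \<in> E")
          case True
          then have "cod E a b = 3" using c3 cod_adj_less(1)[OF True] in_ab by simp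
          then have N3: "card N = 3" "finite N" unfolding N_def cod_def by auto
          have ab_N: "a \<notin> N" "b \<notin> N" unfolding N_def by auto
          have a: "nb E a = insert b N" using True N3 ab_N in_ab by (intro nb_eqI) (auto simp: N_def)
          have b: "nb E b = insert a N" using E_sym[OF True] N3 ab_N in_ab by (intro nb_eqI) (auto simp: N_def)
          have NV: "N \<subseteq> V" using nb_sub(1)[of a] unfolding N_def by auto
          have "card (V - insert a (insert b N)) = 1"
            using NV in_ab ab(2) ab_N N3 n by (subst card_Diff_subset) auto
          then obtain f where f: "V - insert a (insert b N) = {f}" by (auto simp: card_1_singleton_iff)
          have "x = f" if "(f, x) \<in> E" for x
          proof -
            have xf: "(x, f) \<in> E" "x \<in> V" using that E_sym in_V by auto
            have "f \<notin> nb E a" "f \<notin> nb E b" using a b f ab(2) by auto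
            then have "x \<noteq> a" "x \<noteq> b" using xf by auto
            moreover have "x \<notin> N"
            proof
              assume "x \<in> N"
              then have "f \<in> {a, b}" using nbN[of x] xf(1) in_nb[of f E x] by metis
              then show False using f by blast
            qed
            ultimately show ?thesis using f xf by blast
          qed
          then have "nb E f = {}" using E_irr by (metis all_not_in_conv in_nb)
          then have "deg E f = 0" by (simp add: deg_def)
          then show False using d2[of f] f by auto
        next
          case False
          \<comment> \<open>Degree 4 without the edge \<open>a\<close>, \<open>b\<close> joins both
            vertices to all four others.\<close>
          have X: "card (V - {a, b}) = 4" using in_ab ab(2) n by simp
          have "nb E a = V - {a, b}" using nb_sub(2)[of a] False X in_ab by (intro nb_eqI') auto
          moreover have "nb E b = V - {a, b}"
            using nb_sub(2)[of b] False E_commute X in_ab by (intro nb_eqI') auto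
          moreover have "nb E w = {a, b}" if "w \<in> V - {a, b}" for w
            using nbN that calculation unfolding N_def by auto
          ultimately have nb: "(a, x) \<in> E \<longleftrightarrow> x \<in> V - {a, b}" "(b, x) \<in> E \<longleftrightarrow> x \<in> V - {a, b}"
            "w \<in> V - {a, b} \<Longrightarrow> (w, x) \<in> E \<longleftrightarrow> x \<in> {a, b}" for x w
            by (metis in_nb)+
          have "E = hub_arcs V a b (V - {a, b}) False"
          proof (intro subset_antisym subrelI)
            fix x y assume "(x, y) \<in> E"
            then show "(x, y) \<in> hub_arcs V a b (V - {a, b}) False"
              using nb(1)[of y] nb(2)[of y] nb(3)[of x y] in_V[of x y] unfolding hub_arcs_def by auto
          next
            fix x y assume "(x, y) \<in> hub_arcs V a b (V - {a, b}) False"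
            then show "(x, y) \<in> E"
              using nb(1)[of y] nb(2)[of y] nb(3)[of x y] ab(2) unfolding hub_arcs_def by auto
          qed
          then have "is_hub V E False 4" unfolding is_hub_def using in_ab ab(2) X by blast
          then show False using not_hub by blast
        qed
      qed
      moreover have "x \<in> {a, b} \<and> y \<in> {a, b} \<and> x \<noteq> y" if "(x, y) \<in> P" for x y
        using P_deg[OF that] deg2 that unfolding P_def by force
      ultimately have "P = {}" using P_sym by auto
      then show ?thesis using R_le 1 by simp
    next
      case 2
      then obtain a where a: "F 4 = {a}" by (auto simp: card_1_singleton_iff)
      have "card (F 3) = 2" using 2 F34 by simp
      then obtain b c where bc: "F 3 = {b, c}" "b \<noteq> c" by (auto simp: card_2_iff)
      have mem: "a \<in> V" "b \<in> V" "c \<in> V" "deg E a = 4" "deg E b = 3" "deg E c = 3"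
        using a bc unfolding F_def by blast+
      have P_abc: "x \<in> {a, b, c} \<and> y \<in> {a, b, c} \<and> x \<noteq> y" if "(x, y) \<in> P" for x y
      proof -
        have "deg E w = 3 \<or> deg E w = 4" if "w \<in> V" "3 \<le> deg E w" for w
          using that d4[of w] by auto
        then have "x \<in> F 3 \<union> F 4" "y \<in> F 3 \<union> F 4"
          using P_deg[OF that] that unfolding P_def F_def by auto
        then show ?thesis using that a bc unfolding P_def by auto
      qed
      have cod3: "cod E x y \<le> 3" if "(x, y) \<in> P" for x y
      proof -
        have "x \<in> {b, c} \<or> y \<in> {b, c}" using P_abc[OF that] by auto
        then show ?thesis using cod_le[of x y] mem by auto
      qed
      \<comment> \<open>The unique non-neighbour \<open>q\<close> of \<open>a\<close> controls
        \<open>P\<close>: a vertex of degree 3 paired with \<open>a\<close> has its neighbourhood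
        inside that of \<open>a\<close>, hence is not adjacent to \<open>a\<close>.\<close>
      have "card (V - insert a (nb E a)) = 1"
        using nb_sub(2)[of a] mem n by (subst card_Diff_subset) (auto simp: deg_def)
      then obtain q where q: "V - insert a (nb E a) = {q}" by (auto simp: card_1_singleton_iff)
      have far: "x = q \<longleftrightarrow> (a, x) \<notin> E" if "x \<in> V" "x \<noteq> a" for x
      proof -
        have "x \<in> V - insert a (nb E a) \<longleftrightarrow> x \<in> {q}" by (simp only: q)
        then show ?thesis using that by simp
      qed
      have ne: "a \<noteq> b" "a \<noteq> c" using mem by auto
      have ab: "b = q" if "(b, a) \<in> P"
      proof -
        have "(a, b) \<notin> E" using P_sub[OF that mem(5)] by (metis E_irr E_sym in_nb subsetD)
        then show ?thesis using far mem ne by auto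
      qed
      have ac: "c = q" if "(c, a) \<in> P"
      proof -
        have "(a, c) \<notin> E" using P_sub[OF that mem(6)] by (metis E_irr E_sym in_nb subsetD)
        then show ?thesis using far mem ne by auto
      qed
      have bc': "b = q \<longleftrightarrow> c = q" if "(b, c) \<in> P"
      proof -
        have "nb E b = nb E c" using P_sub[OF that mem(5)] P_sub[OF P_sym[OF that] mem(6)] by blast
        then have "(a, b) \<in> E \<longleftrightarrow> (a, c) \<in> E" using E_commute in_nb by metis
        then show ?thesis using far mem ne by metis
      qed
      \<comment> \<open>Since \<open>b\<close> and \<open>c\<close> differ, at most one of them is
        \<open>q\<close>. A pair with \<open>a\<close> needs its other member to be
        \<open>q\<close>, while the pair \<open>b\<close>, \<open>c\<close> needs both or neither to
        be \<open>q\<close>; hence at most one unordered pair occurs.\<close>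
      have "P \<subseteq> {(a, b), (b, a)} \<or> P \<subseteq> {(a, c), (c, a)} \<or> P \<subseteq> {(b, c), (c, b)}"
        using P_abc P_sym ab ac bc' bc(2) by auto
      then obtain p q where "P \<subseteq> {p, q}" by blast
      then have "card P \<le> card {p, q}" by (intro card_mono) auto
      also have "\<dots> \<le> 2" by (simp add: card_insert_if)
      finally show ?thesis using R_le[OF cod3] 2 by linarith
    next
      case 3
      then have no4: "F 4 = {}" using fin by simp
      have deg3: "deg E w \<le> 3" if "w \<in> V" for w
        using d4[OF that] no4 that unfolding F_def by (cases "deg E w = 4") auto
      have P3: "deg E x = 3" "deg E y = 3" "cod E x y \<le> 3" if "(x, y) \<in> P" for x y
        using P_deg[OF that] deg3 that cod_le[of x y] unfolding P_def by force+
      \<comment> \<open>Pairs in \<open>P\<close> now have equal neighbourhoods of size 3. A vertex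
        in two such pairs would give three vertices all joined to the same three others, so six
        vertices of degree at least 3 and 18 > 16 arcs.\<close>
      have "inj_on fst P"
      proof (rule inj_onI)
        fix p q assume pq: "p \<in> P" "q \<in> P" "fst p = fst q"
        then obtain u v w where uvw: "p = (u, v)" "q = (u, w)" by (metis prod.collapse)
        have N: "nb E v = nb E u" "nb E w = nb E u"
          using P_sub P_sym P3 pq uvw by (meson subset_antisym)+
        have mem: "u \<in> V" "v \<in> V" "w \<in> V" "u \<noteq> v" "u \<noteq> w" using pq uvw unfolding P_def by auto
        have "v = w"
        proof (rule ccontr)
          assume "v \<noteq> w"
          then have c: "card {u, v, w} = 3" using mem by simp
          have d: "deg E u = 3" "deg E v = 3" "deg E w = 3" using P3 pq uvw by auto
          have "3 \<le> deg E x" if "x \<in> nb E u" for x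
          proof -
            have "x \<in> nb E v" "x \<in> nb E w" using that N by simp_all
            then have "{u, v, w} \<subseteq> nb E x" using that E_sym by simp
            then show ?thesis using c card_mono[OF finite_nb] unfolding deg_def by metis
          qed
          then have "3 \<le> deg E x" if "x \<in> {u, v, w} \<union> nb E u" for x using that d by auto
          moreover have disj: "{u, v, w} \<inter> nb E u = {}"
          proof -
            have "u \<notin> nb E u" "v \<notin> nb E v" "w \<notin> nb E w" by simp_all
            then show ?thesis unfolding N by simp
          qed
          ultimately have "(\<Sum>x\<in>{u, v, w} \<union> nb E u. 3) \<le> (\<Sum>x\<in>{u, v, w} \<union> nb E u. deg E x)"
            by (intro sum_mono)
          also have "\<dots> \<le> (\<Sum>x\<in>V. deg E x)" using mem nb_sub by (intro sum_mono2) auto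
          finally have "3 * card ({u, v, w} \<union> nb E u) \<le> 16" using sum_deg E by simp
          moreover have "card ({u, v, w} \<union> nb E u) = 6"
            using disj c d by (subst card_Un_disjoint) (auto simp: deg_def)
          ultimately show False by simp
        qed
        then show "p = q" using uvw by simp
      qed
      then have "card P = card (fst ` P)" by (simp add: card_image)
      also have "\<dots> \<le> card (F 3)" using P3 fin by (intro card_mono) (auto simp: F_def P_def)
      also have "\<dots> = 4" using F34 3 by simp
      finally show ?thesis using R_le[OF P3(3)] 3 by linarith
    qed
  qed
  then show "32 \<le> quad V E" using w unfolding quad_def E by simp
qed

end

section \<open>Walk counts of the two extremal families\<close>

locale hub =
  fixes V :: "'a set" and a b :: 'a and X :: "'a set" and J :: bool
  assumes finite_V: "finite V" and a: "a \<in> V" and b: "b \<in> V" and ab: "a \<noteq> b" and X_sub: "X \<subseteq> V - {a, b}"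
begin

abbreviation "E \<equiv> hub_arcs V a b X J"

sublocale sgraph V E
  by unfold_locales (auto simp: hub_arcs_def finite_V)

definition "Y = V - {a, b}"
definition "j = (if J then 1 else 0 :: nat)"

lemma X_Y: "X \<subseteq> Y" and fin: "finite Y" "finite X" and notin: "a \<notin> Y" "b \<notin> Y" "a \<notin> X" "b \<notin> X"
  using X_sub finite_V finite_subset[OF X_sub] unfolding Y_def by auto

lemma card_Y: "card V = card Y + 2"
proof -
  have "card Y = card V - 2"
    unfolding Y_def using a b ab finite_V by (subst card_Diff_subset) auto
  moreover have "card {a, b} \<le> card V" using a b finite_V by (intro card_mono) auto
  ultimately show ?thesis using ab by simp
qed

lemma sum_V: "sum f V = f a + (f b + sum f Y)" for f :: "'a \<Rightarrow> nat"
proof -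
  have "V - {a} - {b} = Y" unfolding Y_def by blast
  then show ?thesis
    using sum.remove[OF finite_V a, of f] sum.remove[of "V - {a}" b f] finite_V b ab by simp
qed

lemma nb_a: "nb E a = (if J then insert b Y else Y)"
  using a b ab X_sub unfolding hub_arcs_def Y_def by auto

lemma nb_b: "nb E b = (if J then insert a X else X)"
  using a b ab X_sub unfolding hub_arcs_def by auto

lemma nb_Y: "w \<in> Y \<Longrightarrow> nb E w = (if w \<in> X then {a, b} else {a})"
  using a b ab X_sub unfolding hub_arcs_def Y_def by auto

lemma deg_a: "deg E a = card Y + j" and deg_b: "deg E b = card X + j"
  and deg_Y: "w \<in> Y \<Longrightarrow> deg E w = 1 + (if w \<in> X then 1 else 0)"
  using fin notin ab by (auto simp: deg_def nb_a nb_b nb_Y j_def)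

lemma cod_ab: "cod E a b = card X"
proof -
  have "Y \<inter> X = X" using X_Y by auto
  then show ?thesis using notin ab by (auto simp: cod_def nb_a nb_b)
qed

lemma cod_aw: "w \<in> Y \<Longrightarrow> cod E a w = (if w \<in> X then j else 0)"
  using notin ab by (auto simp: cod_def nb_a nb_Y j_def)

lemma cod_bw: "w \<in> Y \<Longrightarrow> cod E b w = j"
  using notin ab by (auto simp: cod_def nb_b nb_Y j_def)

lemma cod_ww: "v \<in> Y \<Longrightarrow> w \<in> Y \<Longrightarrow> cod E v w = 1 + (if v \<in> X then if w \<in> X then 1 else 0 else 0)"
  using notin ab by (auto simp: cod_def nb_Y)

lemma sum_X: "(\<Sum>w\<in>Y. if w \<in> X then c else 0) = c * card X" for c :: nat
proof -
  have "Y \<inter> X = X" using X_Y by auto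
  then show ?thesis using fin by (simp add: sum.If_cases)
qed

lemma card_hub_arcs: "card E = 2 * card Y + 2 * card X + 2 * j"
proof -
  have "card E = card Y + j + (card X + j + (\<Sum>w\<in>Y. 1 + (if w \<in> X then 1 else 0)))"
    unfolding sum_deg[symmetric] sum_V deg_a deg_b by (simp add: deg_Y)
  then show ?thesis using sum_X[of 1] by (simp only: sum.distrib) simp
qed

lemma sum_nb_a: "sum f (nb E a) = j * f b + sum f Y"
  and sum_nb_b: "sum f (nb E b) = j * f a + sum f X"
  unfolding nb_a nb_b j_def using fin notin by simp_all

lemma walks3_hub: "walks3 E = 6 * (card X * j)"
proof -
  have "(\<Sum>w\<in>Y. cod E a w) = j * card X" using sum_X[of j] by (simp add: cod_aw)
  then have "(\<Sum>v\<in>nb E a. cod E a v) = j * card X + j * card X"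
    by (simp add: sum_nb_a cod_ab)
  moreover have "(\<Sum>v\<in>nb E b. cod E b v) = j * card X + j * card X"
  proof -
    have "(\<Sum>v\<in>X. cod E b v) = (\<Sum>v\<in>X. j)" using X_Y by (intro sum.cong) (auto simp: cod_bw)
    then show ?thesis by (simp add: sum_nb_b cod_ab cod_commute[of E b a])
  qed
  moreover have "(\<Sum>w\<in>Y. \<Sum>v\<in>nb E w. cod E w v) = (\<Sum>w\<in>Y. if w \<in> X then 2 * j else 0)"
  proof (intro sum.cong refl)
    fix w assume w: "w \<in> Y"
    have "cod E w a = (if w \<in> X then j else 0)" "cod E w b = j"
      using cod_aw cod_bw w by (metis cod_commute)+
    then show "(\<Sum>v\<in>nb E w. cod E w v) = (if w \<in> X then 2 * j else 0)"
      using ab w by (simp add: nb_Y)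
  qed
  ultimately show ?thesis
    using sum_X[of "2 * j"] by (simp add: walks3_def sum_arcs sum_V)
qed

lemma walks4_hub:
  "walks4 V E = (card Y + j)\<^sup>2 + (card X + j)\<^sup>2 + 2 * (card X)\<^sup>2 + 2 * (j * card X) + 2 * (j * card Y)
     + (card Y)\<^sup>2 + 3 * (card X)\<^sup>2"
proof -
  have jj: "j\<^sup>2 = j" by (simp add: j_def)
  have aw: "(\<Sum>w\<in>Y. (cod E a w)\<^sup>2) = j * card X"
  proof -
    have "(\<Sum>w\<in>Y. (cod E a w)\<^sup>2) = (\<Sum>w\<in>Y. if w \<in> X then j else 0)"
      by (intro sum.cong refl) (auto simp: cod_aw jj)
    then show ?thesis using sum_X by simp
  qed
  have bw: "(\<Sum>w\<in>Y. (cod E b w)\<^sup>2) = j * card Y"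
  proof -
    have "(\<Sum>w\<in>Y. (cod E b w)\<^sup>2) = (\<Sum>w\<in>Y. j)" by (intro sum.cong refl) (simp add: cod_bw jj)
    then show ?thesis by simp
  qed
  have "(\<Sum>v\<in>Y. \<Sum>w\<in>Y. (cod E v w)\<^sup>2) = (\<Sum>v\<in>Y. \<Sum>w\<in>Y. 1 + (if v \<in> X then if w \<in> X then 3 else 0 else 0))"
    by (intro sum.cong refl) (auto simp: cod_ww power2_eq_square)
  also have "\<dots> = (\<Sum>v\<in>Y. card Y + (if v \<in> X then 3 * card X else 0))"
  proof (intro sum.cong refl)
    fix v
    show "(\<Sum>w\<in>Y. 1 + (if v \<in> X then if w \<in> X then 3 else 0 else 0)) = card Y + (if v \<in> X then 3 * card X else 0)"
      using sum_X[of 3] by (cases "v \<in> X") (simp_all only: sum.distrib if_True if_False, simp_all)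
  qed
  also have "\<dots> = (card Y)\<^sup>2 + 3 * (card X)\<^sup>2"
    using sum_X[of "3 * card X"] by (simp only: sum.distrib) (simp add: power2_eq_square)
  finally have ww: "(\<Sum>v\<in>Y. \<Sum>w\<in>Y. (cod E v w)\<^sup>2) = (card Y)\<^sup>2 + 3 * (card X)\<^sup>2" .
  have wa: "(\<Sum>w\<in>Y. (cod E w a)\<^sup>2) = j * card X" and wb: "(\<Sum>w\<in>Y. (cod E w b)\<^sup>2) = j * card Y"
    using aw bw by (simp_all add: cod_commute[of E a] cod_commute[of E b])
  have ba: "cod E b a = card X" using cod_ab cod_commute by metis
  show ?thesis
    unfolding walks4_def sum_V by (simp add: sum.distrib aw bw wa wb ww ba cod_ab deg_a deg_b)
qed

end

lemma is_hub_hub: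
  assumes "finite V" "is_hub V E J k"
  obtains a b X where "hub V a b X" "card X = k" "E = hub_arcs V a b X J"
  using assms unfolding is_hub_def hub_def by blast

lemma is_hub_sgraph: "finite V \<Longrightarrow> is_hub V E J k \<Longrightarrow> sgraph V E"
proof (elim is_hub_hub)
  fix a b X assume "hub V a b X" and E: "E = hub_arcs V a b X J"
  then interpret hub V a b X J by simp
  show "sgraph V E" unfolding E by (rule sgraph_axioms)
qed

lemma
  assumes "finite V" "is_hub V E True 3"
  shows hub_True3_card: "card E = 2 * card V + 4"
    and hub_True3_walks3: "walks3 E = 18"
    and hub_True3_quad: "quad V E = 24 * (int (card V) - 5)"
proof -
  obtain a b X where h: "a \<in> V" "b \<in> V" "a \<noteq> b" "X \<subseteq> V - {a, b}" "card X = 3" "E = hub_arcs V a b X True"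
    using assms(2) unfolding is_hub_def by blast
  interpret hub V a b X True by unfold_locales (use assms h in auto)
  show c: "card E = 2 * card V + 4" using card_hub_arcs card_Y h by (simp add: j_def)
  show "walks3 E = 18" using walks3_hub h by (simp add: j_def)
  have "int (walks4 V E) = 2 * (int (card V))\<^sup>2 - 4 * int (card V) + 68"
    unfolding h(6) walks4_hub using h(5) card_Y by (simp add: j_def power2_eq_square algebra_simps)
  then show "quad V E = 24 * (int (card V) - 5)"
    unfolding quad_def c by (simp add: power2_eq_square algebra_simps)
qed

lemma
  assumes "finite V" "is_hub V E False 4"
  shows hub_False4_card: "card E = 2 * card V + 4"
    and hub_False4_walks3: "walks3 E = 0"
    and hub_False4_quad: "quad V E = 32 * (int (card V) - 6)"
proof -
  obtain a b X where h: "a \<in> V" "b \<in> V" "a \<noteq> b" "X \<subseteq> V - {a, b}" "card X = 4" "E = hub_arcs V a b X False"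
    using assms(2) unfolding is_hub_def by blast
  interpret hub V a b X False by unfold_locales (use assms h in auto)
  show c: "card E = 2 * card V + 4" using card_hub_arcs card_Y h by (simp add: j_def)
  show "walks3 E = 0" using walks3_hub h by (simp add: j_def)
  have "int (walks4 V E) = 2 * (int (card V))\<^sup>2 - 8 * int (card V) + 104"
    unfolding h(6) walks4_hub using h(5) card_Y by (simp add: j_def power2_eq_square algebra_simps)
  then show "quad V E = 32 * (int (card V) - 6)"
    unfolding quad_def c by (simp add: power2_eq_square algebra_simps)
qed

text \<open>The degree condition says that \<open>u\<close> is adjacent, before \<open>v\<close> is
  attached, to as many vertices as there are non-hubs, which is at least 4. Non-hubs have degree at
  most 2, so \<open>u\<close> is a hub; if it is \<open>b\<close>, then \<open>X\<close> contains
  all non-hubs and the two hubs are interchangeable.\<close>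

lemma (in pendant) hub_extend:
  assumes h: "is_hub V' E' False 4" and d: "deg E u + 2 = card V" and n: "7 \<le> card V"
  shows "is_hub V E False 4"
proof -
  interpret G': sgraph V' E' by (rule sgraph')
  obtain a b X where abX: "a \<in> V'" "b \<in> V'" "a \<noteq> b" "X \<subseteq> V' - {a, b}" "card X = 4" "E' = hub_arcs V' a b X False"
    using h unfolding is_hub_def by blast
  interpret h: hub V' a b X False by unfold_locales (use abX in auto)
  have dY: "deg E' u = card h.Y" "4 \<le> card h.Y"
    using d n deg_u card_V' h.card_Y by auto
  have extend: "is_hub V E False 4"
    if "u \<in> V'" "c \<in> V'" "u \<noteq> c" "Z \<subseteq> V' - {u, c}" "card Z = 4" "E' = hub_arcs V' u c Z False" for c Z
  proof -
    have "E = E' \<union> {(u, v), (v, u)}" using vu unfolding E'_def by auto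
    also have "\<dots> = hub_arcs V u c Z False"
      unfolding that(6) using that(1-4) vu unfolding hub_arcs_def V'_def by (auto simp: doubleton_eq_iff)
    finally show ?thesis unfolding is_hub_def using that unfolding V'_def by blast
  qed
  have "u \<notin> h.Y" using h.deg_Y dY unfolding abX(6) by (auto split: if_splits)
  then have "u = a \<or> u = b" using vu unfolding h.Y_def by auto
  then show ?thesis
  proof
    assume "u = a" then show ?thesis using extend abX by blast
  next
    assume u: "u = b"
    then have "card X = card h.Y" using dY h.deg_b unfolding abX(6) by (simp add: h.j_def)
    then have X: "X = V' - {a, b}"
      using h.X_Y h.fin card_subset_eq unfolding h.Y_def by metis
    then have "E' = hub_arcs V' b a X False" unfolding abX(6) hub_arcs_def by auto
    then show ?thesis using extend[of a X] abX u by blast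
  qed
qed

section \<open>Lower bounds for b_4 without a dominating vertex\<close>

lemma order4_complete:
  assumes "sgraph V E" "card V = 4" "card E = 12"
  shows "E = {(u, v). u \<in> V \<and> v \<in> V \<and> u \<noteq> v}"
proof -
  interpret sgraph V E by fact
  have sub: "E \<subseteq> V \<times> V - Id_on V" using in_V by auto
  have "card (V \<times> V - Id_on V) = card (V \<times> V) - card (Id_on V)"
    by (intro card_Diff_subset) (auto intro: finite_subset[of _ "V \<times> V"])
  also have "Id_on V = (\<lambda>x. (x, x)) ` V" by (auto simp: Id_on_def)
  then have "card (Id_on V) = 4" using assms(2) by (simp add: card_image inj_on_def)
  finally have "card (V \<times> V - Id_on V) = 12" using assms(2) by (simp add: card_cartesian_product)
  then have "E = V \<times> V - Id_on V" using sub assms(3) by (intro card_subset_eq) auto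
  then show ?thesis by auto
qed

text \<open>Deleting a pendant vertex at order 6 may create a dominating vertex, so both kinds of
  graphs of order 5 are covered by one bound.\<close>

lemma quad_order5_ge:
  assumes "sgraph V E" "card V = 5" "card E = 14"
  shows "0 \<le> quad V E"
proof -
  interpret sgraph V E by fact
  show ?thesis
  proof (cases "cone V E")
    case True
    then obtain z where "coned V E z" using coned_if_cone assms by auto
    then show ?thesis using coned.quad_cone_ge assms by fastforce
  next
    case False then show ?thesis using quad_order5 assms by simp
  qed
qed

lemma quad_order6:
  assumes "sgraph V E" "no_cut V E" "card V = 6" "card E = 16" "\<not> cone V E"
  shows "32 \<le> quad V E \<or> is_hub V E False 4"
proof -
  interpret sgraph V E by fact
  show ?thesis
  proof (cases "\<exists>v\<in>V. deg E v = 1")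
    case False
    have "2 \<le> deg E u" if "u \<in> V" for u
      using deg_pos[OF assms(2) that] False that assms(3) by (cases "deg E u = 1") auto
    then show ?thesis using order6_min_deg2 assms by blast
  next
    case True
    then obtain u v where "pendant V E u v" using pendant_if_deg1 by blast
    then interpret pendant V E u v .
    \<comment> \<open>With \<open>deg E u\<close> \<le> 4 the increment of \<open>quad\<close> is at
      least 4 * 16 - 8 * 4 = 32.\<close>
    have "0 \<le> quad V' E'" using quad_order5_ge[OF sgraph'] card_V' card_E' assms by simp
    moreover have "deg E u \<le> 4" using deg_not_cone[OF assms(5) vu(4)] assms(3) by simp
    ultimately show ?thesis using quad' assms(4) by simp
  qed
qed

text \<open>The slope 32 is the least increment when a pendant vertex is attached to a vertex whose
  degree becomes at most two less than the order. The inequality is kept strict outside the hub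
  graph, so that equality propagates only along hub graphs.\<close>

lemma quad_not_cone:
  assumes "6 \<le> card V" "sgraph V E" "no_cut V E" "card E = 2 * card V + 4" "\<not> cone V E"
  shows "32 * (int (card V) - 6) < quad V E \<or> is_hub V E False 4"
  using assms
proof (induction "card V" arbitrary: V E rule: nat_induct_at_least)
  case base
  then show ?case using quad_order6[of V E] by auto
next
  case (Suc n)
  interpret sgraph V E by fact
  have n: "card V = n + 1" "6 \<le> n" using Suc by auto
  show ?case
  proof (cases "\<exists>v\<in>V. deg E v = 1")
    case False
    have "2 \<le> deg E u" if "u \<in> V" for u
      using deg_pos[OF Suc.prems(2) that] False that n by (cases "deg E u = 1") auto
    then have "walks4 V E \<le> 8 * card V + 88" using walks4_min_deg2 Suc.prems by blast
    then have "(2 * int n + 6)\<^sup>2 - 16 * int n - 192 \<le> quad V E"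
    proof -
      have "int (walks4 V E) \<le> 8 * int n + 96" and E: "int (card E) = 2 * int n + 6"
        using \<open>walks4 V E \<le> 8 * card V + 88\<close> Suc.prems n by auto
      then show ?thesis unfolding quad_def E by simp
    qed
    \<comment> \<open>The order is n + 1 here, and the difference of the two sides is 4 n (n - 6) +
      4; this is positive from n = 6 on, so the estimate suffices from order 7.\<close>
    moreover have "32 * (int n - 5) < (2 * int n + 6)\<^sup>2 - 16 * int n - 192"
    proof -
      have "0 \<le> (int n - 6) * (4 * int n)" using n by simp
      then show ?thesis by (simp add: power2_eq_square algebra_simps)
    qed
    ultimately show ?thesis using n by simp
  next
    case True
    then obtain u v where "pendant V E u v" using pendant_if_deg1 by blast
    then interpret pendant V E u v .
    have c': "card V' = n" "card E' = 2 * card V' + 4" using card_V' card_E' n Suc.prems by auto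
    have du: "deg E u + 2 \<le> card V" using deg_not_cone Suc.prems vu by blast
    show ?thesis
    proof (cases "cone V' E'")
      case True
      then obtain z where "coned V' E' z" using sgraph.coned_if_cone[OF sgraph'] c' by blast
      then interpret C: coned V' E' z .
      have dz: "n = deg E' z + 1" using C.card_V c' C.deg_z by simp
      have "u \<noteq> z" using dz deg_u du n by auto
      \<comment> \<open>Most arcs of the smaller graph are at \<open>z\<close>, so \<open>u\<close>
        has small degree. The increment 4 (2 n + 6) - 40 on top of 24 (n - 5) gives 32 n - 136, well
        above 32 (n - 5).\<close>
      then have "2 * (deg E' u + deg E' z) \<le> card E' + 2" by (rule C.deg_add_le)
      then have "int (deg E u) \<le> 5" using dz deg_u c' by simp
      moreover have "24 * (int n - 5) \<le> quad V' E'" using C.quad_cone_ge c' by simp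
      moreover have "int (card E) = 2 * int n + 6" using Suc.prems n by simp
      ultimately show ?thesis using quad' n by simp
    next
      case False
      have IH: "32 * (int n - 6) < quad V' E' \<or> is_hub V' E' False 4"
        using Suc.hyps(2)[of V' E'] sgraph' no_cut' Suc.prems c' False by blast
      \<comment> \<open>As \<open>deg E u\<close> \<le> n - 1, the increment is at least 32, and it
        exceeds 32 unless \<open>u\<close> attains this degree.\<close>
      have q: "quad V E = quad V' E' + 4 * (2 * int n + 6) - 8 * int (deg E u)"
        using quad' Suc.prems n by simp
      show ?thesis
      proof (cases "is_hub V' E' False 4")
        case True
        then have q': "quad V' E' = 32 * (int n - 6)"
          using hub_False4_quad[of V' E'] sgraph.finite_V[OF sgraph'] c' by simp
        show ?thesis
        proof (cases "deg E u + 2 = card V")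
          case True
          then show ?thesis using hub_extend \<open>is_hub V' E' False 4\<close> n by simp
        next
          case False
          then show ?thesis using q q' du n by simp
        qed
      next
        case False
        then show ?thesis using q IH du n by simp
      qed
    qed
  qed
qed

section \<open>Inequalities between power sums of a real spectrum\<close>

definition psum :: "nat \<Rightarrow> real list \<Rightarrow> real" where
  "psum k xs = (\<Sum>x\<leftarrow>xs. x ^ k)"

lemma psum_simps [simp]: "psum k [] = 0" "psum k (x # xs) = x ^ k + psum k xs"
  by (simp_all add: psum_def)

text \<open>
  \<open>sym2\<close>, \<open>sym3\<close> are 2 e_2 and 6 e_3 for the elementary symmetric functions e_k; \<open>sym21\<close> and \<open>sym211\<close> are the
  monomial symmetric functions m_21 and 2 m_211.  All are written in power sums.
\<close>

definition "sym2 xs = (psum 1 xs)\<^sup>2 - psum 2 xs"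
definition "sym3 xs = psum 1 xs ^ 3 - 3 * psum 1 xs * psum 2 xs + 2 * psum 3 xs"
definition "sym21 xs = psum 1 xs * psum 2 xs - psum 3 xs"
definition "sym211 xs = sym2 xs * psum 2 xs - 2 * psum 1 xs * psum 3 xs + 2 * psum 4 xs"

lemma sym_Nil [simp]: "sym2 [] = 0" "sym3 [] = 0" "sym21 [] = 0" "sym211 [] = 0"
  by (simp_all add: sym2_def sym3_def sym21_def sym211_def)

lemma sym_Cons:
  "sym2 (x # xs) = sym2 xs + 2 * x * psum 1 xs"
  "sym3 (x # xs) = sym3 xs + 3 * x * sym2 xs"
  "sym21 (x # xs) = sym21 xs + x * psum 2 xs + x\<^sup>2 * psum 1 xs"
  "sym211 (x # xs) = sym211 xs + x\<^sup>2 * sym2 xs + 2 * x * sym21 xs"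
  unfolding sym2_def sym3_def sym21_def sym211_def
  by (simp_all add: algebra_simps power2_eq_square power3_eq_cube power4_eq_xxxx)

lemma psum_nonneg: "\<forall>x\<in>set xs. 0 \<le> x \<Longrightarrow> 0 \<le> psum k xs"
  by (induction xs) auto

lemma sym_nonneg:
  assumes "\<forall>x\<in>set xs. 0 \<le> x"
  shows "0 \<le> sym2 xs" "0 \<le> sym3 xs" "0 \<le> sym21 xs" "0 \<le> sym211 xs"
proof -
  have "0 \<le> sym2 xs \<and> 0 \<le> sym3 xs \<and> 0 \<le> sym21 xs \<and> 0 \<le> sym211 xs"
    using assms by (induction xs) (auto simp: sym_Cons psum_nonneg)
  then show "0 \<le> sym2 xs" "0 \<le> sym3 xs" "0 \<le> sym21 xs" "0 \<le> sym211 xs" by auto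
qed

lemma sym_pos:
  assumes "\<forall>x\<in>set xs. 0 < x"
  shows "1 \<le> length xs \<Longrightarrow> 0 < psum 1 xs" "2 \<le> length xs \<Longrightarrow> 0 < sym2 xs" "3 \<le> length xs \<Longrightarrow> 0 < sym3 xs"
proof -
  have "(1 \<le> length xs \<longrightarrow> 0 < psum 1 xs) \<and> (2 \<le> length xs \<longrightarrow> 0 < sym2 xs) \<and> (3 \<le> length xs \<longrightarrow> 0 < sym3 xs)"
    using assms
  proof (induction xs)
    case (Cons x xs)
    have nn: "0 \<le> psum 1 xs" "0 \<le> sym2 xs" "0 \<le> sym3 xs"
    proof -
      have "\<forall>x\<in>set xs. 0 \<le> x" using Cons.prems by (auto simp: less_imp_le)
      then show "0 \<le> psum 1 xs" "0 \<le> sym2 xs" "0 \<le> sym3 xs" by (rule psum_nonneg sym_nonneg)+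
    qed
    then show ?case
      using Cons by (auto simp: sym_Cons Suc_le_eq intro!: add_pos_nonneg add_nonneg_pos mult_pos_pos)
  qed simp
  then show "1 \<le> length xs \<Longrightarrow> 0 < psum 1 xs" "2 \<le> length xs \<Longrightarrow> 0 < sym2 xs" "3 \<le> length xs \<Longrightarrow> 0 < sym3 xs"
    by auto
qed

lemma sym_length_le2:
  assumes "length xs \<le> 2" shows "sym3 xs = 0" "sym211 xs = 0"
proof -
  consider "xs = []" | x where "xs = [x]" | x y where "xs = [x, y]"
    using assms by (cases xs; cases "tl xs") (auto simp: neq_Nil_conv)
  then have "sym3 xs = 0 \<and> sym211 xs = 0" by cases (simp_all add: sym_Cons)
  then show "sym3 xs = 0" "sym211 xs = 0" by auto
qed

lemma sym2_length_le1: "length xs \<le> 1 \<Longrightarrow> sym2 xs = 0"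
  by (cases xs) (auto simp: sym_Cons)

text \<open>The negative eigenvalues enter with reversed sign, so that nonnegativity of symmetric
  functions applies to both lists.\<close>

definition "pos_part xs = filter (\<lambda>x. 0 < x) (xs :: real list)"
definition "neg_part xs = map uminus (filter (\<lambda>x. x < 0) (xs :: real list))"

lemma psum_parts:
  assumes "0 < k" shows "psum k xs = psum k (pos_part xs) + (- 1) ^ k * psum k (neg_part xs)"
proof (induction xs)
  case (Cons x xs)
  have "(- 1) ^ k * (- x) ^ k = x ^ k" by (simp flip: power_mult_distrib)
  then show ?case
    using Cons assms
    by (cases x "0 :: real" rule: linorder_cases) (simp_all add: pos_part_def neg_part_def distrib_left)
qed (simp add: pos_part_def neg_part_def)

lemma abs_parts: "(\<Sum>x\<leftarrow>xs. \<bar>x\<bar>) = psum 1 (pos_part xs) + psum 1 (neg_part xs)"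
  by (induction xs) (auto simp: pos_part_def neg_part_def)

lemma length_parts: "length (pos_part xs) + length (neg_part xs) = length (filter (\<lambda>x. x \<noteq> 0) xs)"
  by (induction xs) (auto simp: pos_part_def neg_part_def)

text \<open>For a graph, \<open>M\<close> is 2 m, \<open>T\<close> is 6 t and \<open>Q\<close> is 8
  b_4, so \<open>T\<^sup>2 / 9\<close> is 4 t^2 and \<open>p\<^sup>2 * Q / 2\<close> is 4 p^2
  b_4.\<close>

locale real_spectrum =
  fixes xs :: "real list" and p M T Q :: real
  assumes trace: "psum 1 xs = 0" and p: "(\<Sum>x\<leftarrow>xs. \<bar>x\<bar>) = 2 * p"
    and M: "psum 2 xs = M" and T: "psum 3 xs = T" and Q: "M\<^sup>2 - 2 * psum 4 xs = Q"
    and T_nonneg: "0 \<le> T"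
begin

abbreviation "P \<equiv> pos_part xs"
abbreviation "N \<equiv> neg_part xs"

lemma parts_pos: "\<forall>x\<in>set P. 0 < x" "\<forall>x\<in>set N. 0 < x"
  by (auto simp: pos_part_def neg_part_def)

lemma parts_nonneg: "\<forall>x\<in>set P. 0 \<le> x" "\<forall>x\<in>set N. 0 \<le> x"
  using parts_pos by auto

lemma parts:
  "psum 1 P = p" "psum 1 N = p" "psum 2 P + psum 2 N = M" "psum 3 P - psum 3 N = T"
  "Q = M\<^sup>2 - 2 * (psum 4 P + psum 4 N)"
  using trace p M T Q psum_parts[of 1 xs] psum_parts[of 2 xs] psum_parts[of 3 xs] psum_parts[of 4 xs]
  by (simp_all add: abs_parts)

lemma p_nonneg: "0 \<le> p"
  using psum_nonneg[OF parts_nonneg(1), of 1] parts(1) by simp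

lemma p_sq: "p\<^sup>2 - M / 2 = (sym2 P + sym2 N) / 2"
  unfolding sym2_def parts(1,2) parts(3)[symmetric] by (simp add: field_simps)

lemma p_sq_ge: "M / 2 \<le> p\<^sup>2"
  using p_sq sym_nonneg(1)[OF parts_nonneg(1)] sym_nonneg(1)[OF parts_nonneg(2)] by simp

text \<open>With b_4 = Q / 8, this is e_2(P) e_2(N) = b_4 + p e_3(P) + p e_3(N) - e_4(P) - e_4(N).\<close>

lemma sym2_prod:
  "2 * (sym2 P * sym2 N) = Q + p * (sym3 P + sym3 N) + (sym211 P + sym211 N)"
  unfolding sym2_def sym3_def sym211_def parts(1,2,5) parts(3)[symmetric]
  by (simp add: algebra_simps power2_eq_square power3_eq_cube power4_eq_xxxx)

text \<open>Newton's identity p_3 = e_1^3 - 3 e_1 e_2 + 3 e_3 for both parts; the cubes cancel in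
  the difference because both parts have the same sum \<open>p\<close>.\<close>

lemma sym2_diff: "3 * p * (sym2 N - sym2 P) = 2 * T - sym3 P + sym3 N"
  unfolding sym2_def sym3_def parts(1,2) parts(4)[symmetric]
  by (simp add: algebra_simps power2_eq_square power3_eq_cube)

text \<open>The identity (x + y)^2 = (y - x)^2 + 4 x y for the values of e_2 on the two parts:
  \<open>p_sq\<close> supplies the sum, \<open>sym2_diff\<close> the difference and
  \<open>sym2_prod\<close> the product.\<close>

lemma master:
  "p\<^sup>2 * (p\<^sup>2 - M / 2)\<^sup>2 = (2 * T - sym3 P + sym3 N)\<^sup>2 / 36
    + p\<^sup>2 * (Q + p * (sym3 P + sym3 N) + (sym211 P + sym211 N)) / 2"
proof -
  have "p\<^sup>2 * (p\<^sup>2 - M / 2)\<^sup>2 = p\<^sup>2 * (sym2 N - sym2 P)\<^sup>2 / 4 + p\<^sup>2 * (sym2 P * sym2 N)"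
    unfolding p_sq by (simp add: field_simps power2_eq_square)
  also have "p\<^sup>2 * (sym2 N - sym2 P)\<^sup>2 / 4 = (3 * p * (sym2 N - sym2 P))\<^sup>2 / 36"
    by (simp add: power_mult_distrib)
  also have "sym2 P * sym2 N = (Q + p * (sym3 P + sym3 N) + (sym211 P + sym211 N)) / 2"
    using sym2_prod by simp
  finally show ?thesis unfolding sym2_diff by simp
qed

text \<open>On expanding the square, the only harmful term is -4 T \<open>sym3 P\<close>. Since T
  \<le> p^3, it is absorbed by the contribution p^3 \<open>sym3 P\<close> of the product term, which
  carries the factor 18 on this scale.\<close>

lemma master_ge: "T\<^sup>2 / 9 + p\<^sup>2 * Q / 2 \<le> p\<^sup>2 * (p\<^sup>2 - M / 2)\<^sup>2"
proof -
  define u v where "u = sym3 P" and "v = sym3 N"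
  have uv: "0 \<le> u" "0 \<le> v" unfolding u_def v_def using sym_nonneg(2) parts_nonneg by auto
  have "psum 3 P \<le> p * psum 2 P" "psum 2 P \<le> p\<^sup>2"
    using sym_nonneg(1,3)[OF parts_nonneg(1)] unfolding sym2_def sym21_def parts(1) by auto
  then have "psum 3 P \<le> p * p\<^sup>2" using mult_left_mono[OF _ p_nonneg] by fastforce
  then have T_le: "T \<le> p ^ 3"
    using parts(4) psum_nonneg[OF parts_nonneg(2), of 3] by (simp add: power2_eq_square power3_eq_cube)
  have "4 * T * u \<le> 4 * p ^ 3 * u" using T_le uv by (intro mult_right_mono) auto
  moreover have "0 \<le> p ^ 3 * u" "0 \<le> p ^ 3 * v" "0 \<le> T * v" using p_nonneg uv T_nonneg by auto
  ultimately have "4 * T\<^sup>2 \<le> (2 * T - u + v)\<^sup>2 + 18 * (p ^ 3 * (u + v))"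
    using zero_le_power2[of "v - u"] by (simp add: power2_eq_square algebra_simps)
  moreover have "0 \<le> p\<^sup>2 * (sym211 P + sym211 N)"
    using sym_nonneg(4)[OF parts_nonneg(1)] sym_nonneg(4)[OF parts_nonneg(2)] by simp
  ultimately show ?thesis
    unfolding master u_def v_def by (simp add: field_simps power2_eq_square power3_eq_cube)
qed

text \<open>Four nonzero eigenvalues might still split as 3 + 1. Then e_2 of the short part
  vanishes, and with it the left side of \<open>sym2_prod\<close>, while e_3 of the long part and
  the sign of \<open>Q\<close> make the right side positive. So both parts have at most two members
  and all error terms of \<open>master\<close> vanish.\<close>

lemma master_eq:
  assumes "length (filter (\<lambda>x. x \<noteq> 0) xs) \<le> 4" "0 \<le> Q"
  shows "T\<^sup>2 / 9 + p\<^sup>2 * Q / 2 = p\<^sup>2 * (p\<^sup>2 - M / 2)\<^sup>2"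
proof -
  have small: "length A \<le> 2"
    if AB: "length A + length B \<le> 4" and A: "\<forall>x\<in>set A. 0 < x" "psum 1 A = p"
      and B: "\<forall>x\<in>set B. 0 < x"
      and AB': "2 * (sym2 A * sym2 B) = Q + p * (sym3 A + sym3 B) + (sym211 A + sym211 B)" for A B
  proof (rule ccontr)
    assume "\<not> length A \<le> 2"
    then have "0 < sym3 A" "0 < p" "sym2 B = 0" using sym_pos(1,3)[OF A(1)] sym2_length_le1[of B] A(2) AB by auto
    moreover have "0 \<le> sym3 B" "0 \<le> sym211 A" "0 \<le> sym211 B"
      using sym_nonneg[of A] sym_nonneg[of B] A(1) B by (auto simp: less_imp_le)
    ultimately have "0 < p * (sym3 A + sym3 B)" "0 \<le> sym211 A + sym211 B" "sym2 B = 0"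
      by (auto intro!: mult_pos_pos)
    then show False using AB' assms(2) by simp
  qed
  have "length P + length N \<le> 4" using assms(1) length_parts by simp
  then have "length P \<le> 2" "length N \<le> 2"
    using small[of P N] small[of N P] parts_pos parts(1,2) sym2_prod by (simp_all add: mult.commute add.commute)
  then show ?thesis unfolding master by (simp add: sym_length_le2 field_simps)
qed

end

section \<open>Spectra of adjacency matrices\<close>

definition mtrace :: "'a :: comm_ring_1 mat \<Rightarrow> 'a" where
  "mtrace A = (\<Sum>i<dim_row A. A $$ (i, i))"

lemma mtrace_mult:
  assumes "A \<in> carrier_mat n m" "B \<in> carrier_mat m n"
  shows "mtrace (A * B) = (\<Sum>i<n. \<Sum>j<m. A $$ (i, j) * B $$ (j, i))"
  using assms unfolding mtrace_def by (auto simp: scalar_prod_def lessThan_atLeast0 intro!: sum.cong)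

lemma mtrace_comm:
  assumes "A \<in> carrier_mat n m" "B \<in> carrier_mat m n"
  shows "mtrace (A * B) = mtrace (B * A)"
  unfolding mtrace_mult[OF assms] mtrace_mult[OF assms(2,1)]
  by (subst sum.swap) (simp add: mult.commute)

lemma mtrace_similar:
  assumes "similar_mat_wit A B P Q" shows "mtrace A = mtrace B"
proof -
  define n where "n = dim_row A"
  note wit = similar_mat_witD[OF n_def assms]
  have "mtrace A = mtrace (P * B * Q)" using wit(3) by simp
  also have "\<dots> = mtrace (Q * (P * B))" using wit by (intro mtrace_comm) auto
  also have "Q * (P * B) = B" using wit by (simp flip: assoc_mult_mat)
  finally show ?thesis .
qed

lemma upper_triangular_mult:
  assumes "A \<in> carrier_mat n n" "B \<in> carrier_mat n n" "upper_triangular A" "upper_triangular B"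
  shows "upper_triangular (A * B)" "i < n \<Longrightarrow> (A * B) $$ (i, i) = A $$ (i, i) * B $$ (i, i)"
proof -
  have AB: "(A * B) $$ (i, j) = (\<Sum>k<n. A $$ (i, k) * B $$ (k, j))" if "i < n" "j < n" for i j
    using assms(1,2) that by (auto simp: scalar_prod_def lessThan_atLeast0 intro!: sum.cong)
  have zA: "A $$ (i, j) = 0" if "j < i" "i < n" for i j
    using assms(1,3) that by auto
  have zB: "B $$ (i, j) = 0" if "j < i" "i < n" for i j
    using assms(2,4) that by auto
  show "upper_triangular (A * B)"
  proof
    fix i j assume ij: "j < i" "i < dim_row (A * B)"
    then have "A $$ (i, k) * B $$ (k, j) = 0" if "k < n" for k
      using zA[of k i] zB[of j k] assms(1) that by (cases "k < i") auto
    then show "(A * B) $$ (i, j) = 0" using AB[of i j] ij assms(1) by simp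
  qed
  assume i: "i < n"
  have "(\<Sum>k<n. A $$ (i, k) * B $$ (k, i)) = (\<Sum>k<n. if k = i then A $$ (i, i) * B $$ (i, i) else 0)"
  proof (intro sum.cong refl)
    fix k assume "k \<in> {..<n}"
    then show "A $$ (i, k) * B $$ (k, i) = (if k = i then A $$ (i, i) * B $$ (i, i) else 0)"
      using zA[of k i] zB[of i k] i by (cases k i rule: linorder_cases) auto
  qed
  then show "(A * B) $$ (i, i) = A $$ (i, i) * B $$ (i, i)" using AB i by simp
qed

lemma upper_triangular_pow:
  assumes "A \<in> carrier_mat n n" "upper_triangular A"
  shows "upper_triangular (A ^\<^sub>m k) \<and> (\<forall>i<n. (A ^\<^sub>m k) $$ (i, i) = (A $$ (i, i)) ^ k)"
proof (induction k)
  case (Suc k)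
  have "A ^\<^sub>m k \<in> carrier_mat n n" using assms by simp
  then show ?case
    using Suc upper_triangular_mult[of "A ^\<^sub>m k" n A] assms by (simp add: power_commutes)
qed (use assms in simp)

text \<open>Schur triangularisation: the diagonal of a power of a triangular matrix consists of the
  powers of its diagonal entries.\<close>

lemma mtrace_pow:
  fixes A :: "complex mat"
  assumes A: "A \<in> carrier_mat n n" and es: "char_poly A = (\<Prod>e\<leftarrow>es. [:- e, 1:])"
  shows "mtrace (A ^\<^sub>m k) = (\<Sum>e\<leftarrow>es. e ^ k)"
proof -
  obtain B P Q where "schur_decomposition A es = (B, P, Q)" by (metis prod_cases3)
  from schur_decomposition[OF A es this]
  have wit: "similar_mat_wit A B P Q" and B: "upper_triangular B" "diag_mat B = es" by auto
  have Bn: "B \<in> carrier_mat n n" using similar_mat_witD2[OF A wit] by auto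
  have "mtrace (A ^\<^sub>m k) = mtrace (B ^\<^sub>m k)"
    by (rule mtrace_similar[OF similar_mat_wit_pow[OF wit]])
  also have "\<dots> = (\<Sum>i<n. (B $$ (i, i)) ^ k)"
    using upper_triangular_pow[OF Bn B(1), of k] Bn unfolding mtrace_def by (auto intro!: sum.cong)
  also have "\<dots> = (\<Sum>e\<leftarrow>es. e ^ k)"
    using Bn unfolding B(2)[symmetric] diag_mat_def by (simp add: o_def interv_sum_list_conv_sum_set_nat lessThan_atLeast0)
  finally show ?thesis .
qed

lemma order_linear_factors:
  fixes es :: "'a :: field list"
  shows "Polynomial.order z (\<Prod>e\<leftarrow>es. [:- e, 1:]) = count_list es z" "(\<Prod>e\<leftarrow>es. [:- e, 1:]) \<noteq> 0"
proof -
  show nz: "(\<Prod>e\<leftarrow>es. [:- e, 1:]) \<noteq> 0" for es :: "'a list"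
    by (auto simp: prod_list_zero_iff)
  show "Polynomial.order z (\<Prod>e\<leftarrow>es. [:- e, 1:]) = count_list es z"
  proof (induction es)
    case (Cons e es)
    have "Polynomial.order z [:- e, 1:] = (if e = z then 1 else 0)"
      using order_power_n_n[of z 1] by (auto simp: order_0I)
    moreover have "[:- e, 1:] * (\<Prod>e\<leftarrow>es. [:- e, 1:]) \<noteq> 0" using nz[of "e # es"] by simp
    ultimately show ?case using Cons order_mult[of "[:- e, 1:]" "\<Prod>e\<leftarrow>es. [:- e, 1:]" z] by simp
  qed (simp add: order_1_eq_0)
qed

lemma sum_count_list:
  fixes f :: "'a \<Rightarrow> real"
  shows "finite S \<Longrightarrow> set xs \<subseteq> S \<Longrightarrow> (\<Sum>x\<in>S. real (count_list xs x) * f x) = (\<Sum>x\<leftarrow>xs. f x)"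
proof (induction xs)
  case (Cons y xs)
  have "(\<Sum>x\<in>S. real (count_list (y # xs) x) * f x)
      = (\<Sum>x\<in>S. real (count_list xs x) * f x + (if x = y then f x else 0))"
    by (intro sum.cong) (auto simp: algebra_simps)
  then show ?case using Cons by (simp add: sum.distrib)
qed simp

lemma mat_energy_eq:
  assumes A: "A \<in> carrier_mat n n" and es: "char_poly A = (\<Prod>e\<leftarrow>es. [:- e, 1:])"
  shows "mat_energy A = (\<Sum>e\<leftarrow>es. cmod e)"
proof -
  have "spectrum A = set es"
  proof -
    have "poly (\<Prod>e\<leftarrow>es. [:- e, 1:]) z = 0 \<longleftrightarrow> z \<in> set es" for z
      by (induction es) auto
    then show ?thesis using spectrum_root_char_poly[OF A] es by auto
  qed
  then show ?thesis
    unfolding mat_energy_def es order_linear_factors by (simp add: sum_count_list)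
qed

text \<open>For an eigenvector v, the Hermitian form \<open>q\<close> = v* A v equals its own
  conjugate, and it is the eigenvalue times the positive number \<open>s\<close>.\<close>

lemma symmetric_eigenvalue_real:
  fixes A :: "complex mat"
  assumes A: "A \<in> carrier_mat n n" and sym: "\<And>i j. i < n \<Longrightarrow> j < n \<Longrightarrow> cnj (A $$ (i, j)) = A $$ (j, i)"
    and ev: "eigenvalue A k"
  shows "k \<in> \<real>"
proof -
  obtain v where v: "v \<in> carrier_vec n" "v \<noteq> 0\<^sub>v n" "A *\<^sub>v v = k \<cdot>\<^sub>v v"
    using ev A unfolding eigenvalue_def eigenvector_def by auto
  have Av: "(\<Sum>j<n. A $$ (i, j) * v $ j) = k * v $ i" if "i < n" for i
  proof -
    have "(A *\<^sub>v v) $ i = (\<Sum>j<n. A $$ (i, j) * v $ j)"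
      using A v(1) that by (auto simp: scalar_prod_def lessThan_atLeast0 intro!: sum.cong)
    then show ?thesis using v that by simp
  qed
  define q where "q = (\<Sum>i<n. \<Sum>j<n. cnj (v $ i) * A $$ (i, j) * v $ j)"
  define s where "s = (\<Sum>i<n. (cmod (v $ i))\<^sup>2)"
  have "q = (\<Sum>i<n. cnj (v $ i) * (k * v $ i))"
    unfolding q_def by (intro sum.cong refl) (simp add: Av[symmetric] sum_distrib_left mult.assoc)
  also have "\<dots> = k * of_real s"
    unfolding s_def of_real_sum sum_distrib_left by (intro sum.cong refl) (simp only: complex_norm_square mult_ac)
  finally have q: "q = k * of_real s" .
  have "cnj q = (\<Sum>i<n. \<Sum>j<n. cnj (v $ j) * A $$ (j, i) * v $ i)"
    unfolding q_def by (simp add: sym mult_ac)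
  also have "\<dots> = q" unfolding q_def by (rule sum.swap)
  finally have "cnj q = q" .
  obtain i where i: "i < n" "v $ i \<noteq> 0" using v(1,2) by (metis carrier_vecD eq_vecI index_zero_vec(1,2))
  have "0 < (cmod (v $ i))\<^sup>2" using i by simp
  also have "\<dots> \<le> s" unfolding s_def using i by (intro member_le_sum) auto
  finally have "s \<noteq> 0" by simp
  then have "cnj k = k" using q \<open>cnj q = q\<close> by simp
  then show ?thesis by (simp add: Reals_cnj_iff)
qed

section \<open>Nonzero eigenvalues of products of low rank\<close>

lemma char_poly_four_block_lower:
  fixes A :: "'a :: idom mat"
  assumes A: "A \<in> carrier_mat n n" and C: "C \<in> carrier_mat m n" and D: "D \<in> carrier_mat m m"
  shows "char_poly (four_block_mat A (0\<^sub>m n m) C D) = char_poly A * char_poly D"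
proof -
  have "char_poly_matrix (four_block_mat A (0\<^sub>m n m) C D)
      = four_block_mat (char_poly_matrix A) (0\<^sub>m n m) (map_mat (\<lambda>a. [:- a:]) C) (char_poly_matrix D)"
    using A C D unfolding char_poly_matrix_def by (intro eq_matI) auto
  then show ?thesis
    unfolding char_poly_def using A C D
    by (simp add: det_four_block_mat_upper_right_zero[of _ n _ m])
qed

lemma char_poly_mult_swap:
  fixes U :: "'a :: idom mat"
  assumes U: "U \<in> carrier_mat n m" and W: "W \<in> carrier_mat m n"
  shows "char_poly (U * W) * char_poly (0\<^sub>m m m) = char_poly (0\<^sub>m n n) * char_poly (W * U)"
proof -
  define X where "X = four_block_mat (U * W) (0\<^sub>m n m) W (0\<^sub>m m m)"
  define Y where "Y = four_block_mat (0\<^sub>m n n) (0\<^sub>m n m) W (W * U)"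
  define P where "P = four_block_mat (1\<^sub>m n) U (0\<^sub>m m n) (1\<^sub>m m)"
  define Q where "Q = four_block_mat (1\<^sub>m n) (- U) (0\<^sub>m m n) (1\<^sub>m m)"
  have carr: "X \<in> carrier_mat (n + m) (n + m)" "Y \<in> carrier_mat (n + m) (n + m)"
    "P \<in> carrier_mat (n + m) (n + m)" "Q \<in> carrier_mat (n + m) (n + m)"
    using U W unfolding X_def Y_def P_def Q_def by auto
  have one: "four_block_mat (1\<^sub>m n) (0\<^sub>m n m) (0\<^sub>m m n) (1\<^sub>m m) = (1\<^sub>m (n + m) :: 'a mat)"
    by (rule four_block_one_mat)
  have neg0: "- 0\<^sub>m m m + 1\<^sub>m m = (1\<^sub>m m :: 'a mat)"
    by (intro eq_matI) auto
  have negU: "U + - U = 0\<^sub>m n m" "- U + U = 0\<^sub>m n m"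
    using U by (auto intro!: eq_matI)
  have PQ: "P * Q = 1\<^sub>m (n + m)" unfolding P_def Q_def one[symmetric]
    using U by (subst mult_four_block_mat[of _ n n _ m _ m _ _ n _ m]) (auto simp: neg0 negU)
  have QP: "Q * P = 1\<^sub>m (n + m)" unfolding P_def Q_def one[symmetric]
    using U by (subst mult_four_block_mat[of _ n n _ m _ m _ _ n _ m]) (auto simp: neg0 negU)
  have "X * P = four_block_mat (U * W) (U * W * U) W (W * U)" unfolding X_def P_def
    using U W by (subst mult_four_block_mat[of _ n n _ m _ m _ _ n _ m]) auto
  moreover have "P * Y = four_block_mat (U * W) (U * (W * U)) W (W * U)" unfolding Y_def P_def
    using U W by (subst mult_four_block_mat[of _ n n _ m _ m _ _ n _ m]) auto
  ultimately have XP: "X * P = P * Y" using U W by simp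
  have "X = X * (P * Q)" using PQ carr by simp
  also have "\<dots> = P * Y * Q" using XP carr by (simp flip: assoc_mult_mat)
  finally have "similar_mat X Y" using carr PQ QP by (intro similar_matI[of _ _ P Q "n + m"]) auto
  then have "char_poly X = char_poly Y" by (rule char_poly_similar)
  then show ?thesis
    unfolding X_def Y_def using U W by (simp add: char_poly_four_block_lower)
qed

text \<open>Comparing the order of the root 0 on both sides of \<open>char_poly_mult_swap\<close>
  shows that 0 has multiplicity at least n - m. Multiplicities are counted algebraically, as the
  energy requires.\<close>

lemma low_rank_nonzero_eigenvalues:
  fixes U :: "'a :: field mat"
  assumes U: "U \<in> carrier_mat n m" and W: "W \<in> carrier_mat m n"
    and es: "char_poly (U * W) = (\<Prod>e\<leftarrow>es. [:- e, 1:])" and len: "length es = n"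
  shows "length (filter (\<lambda>e. e \<noteq> 0) es) \<le> m"
proof -
  have zero: "char_poly (0\<^sub>m k k :: 'a mat) = [:0, 1:] ^ k" for k
  proof -
    have "diag_mat (0\<^sub>m k k :: 'a mat) = replicate k 0"
      by (intro nth_equalityI) (auto simp: diag_mat_def)
    then show ?thesis
      using char_poly_upper_triangular[of "0\<^sub>m k k :: 'a mat" k] by (simp add: prod_list_replicate)
  qed
  have ord: "Polynomial.order 0 ([:0, 1:] ^ k :: 'a poly) = k" for k
    using order_power_n_n[of 0 k] by simp
  have nz: "char_poly (W * U) \<noteq> 0"
    using degree_monic_char_poly[of "W * U" m] U W by (metis leading_coeff_0_iff mult_carrier_mat one_neq_zero)
  have "Polynomial.order 0 (char_poly (U * W) * [:0, 1:] ^ m) = Polynomial.order 0 ([:0, 1:] ^ n * char_poly (W * U))"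
    using char_poly_mult_swap[OF U W] unfolding zero by simp
  then have "count_list es 0 + m = n + Polynomial.order 0 (char_poly (W * U))"
    using order_linear_factors[where es = es] nz unfolding es by (simp add: order_mult ord)
  then have "n \<le> count_list es 0 + m" by simp
  moreover have "count_list es 0 + length (filter (\<lambda>e. e \<noteq> 0) es) = length es"
    by (induction es) auto
  ultimately show ?thesis using len by simp
qed

section \<open>The spectrum of a graph and its power sums\<close>

lemma sgraph_pair_graph:
  assumes "pair_graph G" shows "sgraph (pverts G) (parcs G)"
proof -
  interpret pair_graph G by fact
  show ?thesis
    using pair_finite_verts in_arcsD1 in_arcsD2 arcs_symmetric no_loops'
    by unfold_locales (auto, blast)
qed

context
  fixes G :: "'a pair_pre_digraph" and xs :: "'a list"
  assumes G: "pair_graph G" and xs: "distinct xs" "set xs = pverts G"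
begin

interpretation sgraph "pverts G" "parcs G"
  using G by (rule sgraph_pair_graph)

lemma A_carrier: "adj_mat xs G \<in> carrier_mat (length xs) (length xs)"
  by (simp add: adj_mat_def)

lemma A_index: "i < length xs \<Longrightarrow> j < length xs \<Longrightarrow> adj_mat xs G $$ (i, j) = (if (xs ! i, xs ! j) \<in> parcs G then 1 else 0)"
  by (simp add: adj_mat_def)

lemma sum_nth: "(\<Sum>i<length xs. f (xs ! i)) = (\<Sum>u\<in>pverts G. f u)"
  using sum.reindex_bij_betw[OF bij_betw_nth[OF xs(1) refl xs(2)[symmetric]], of f] .

lemma A2_index:
  assumes "i < length xs" "j < length xs" shows "(adj_mat xs G * adj_mat xs G) $$ (i, j) = of_nat (cod (parcs G) (xs ! i) (xs ! j))"
proof -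
  have "(adj_mat xs G * adj_mat xs G) $$ (i, j) = (\<Sum>k<length xs. adj_mat xs G $$ (i, k) * adj_mat xs G $$ (k, j))"
    using assms A_carrier by (auto simp: scalar_prod_def lessThan_atLeast0 intro!: sum.cong)
  also have "\<dots> = (\<Sum>k<length xs. if (xs ! k, xs ! i) \<in> parcs G \<and> (xs ! k, xs ! j) \<in> parcs G then 1 else 0)"
    using assms E_sym by (intro sum.cong refl) (auto simp: A_index)
  also have "\<dots> = of_nat (cod (parcs G) (xs ! i) (xs ! j))"
    unfolding cod_as_sum of_nat_sum
    by (subst sum_nth[of "\<lambda>w. if (w, xs ! i) \<in> parcs G \<and> (w, xs ! j) \<in> parcs G then 1 else 0"]) (auto intro!: sum.cong)
  finally show ?thesis .
qed

lemma A2_carrier: "adj_mat xs G * adj_mat xs G \<in> carrier_mat (length xs) (length xs)"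
  using A_carrier by simp

lemma mtrace_A_pow:
  "mtrace (adj_mat xs G ^\<^sub>m 1) = 0" "mtrace (adj_mat xs G ^\<^sub>m 2) = of_nat (card (parcs G))"
  "mtrace (adj_mat xs G ^\<^sub>m 3) = of_nat (walks3 (parcs G))" "mtrace (adj_mat xs G ^\<^sub>m 4) = of_nat (walks4 (pverts G) (parcs G))"
proof -
  have p: "adj_mat xs G ^\<^sub>m 1 = adj_mat xs G" "adj_mat xs G ^\<^sub>m 2 = adj_mat xs G * adj_mat xs G" "adj_mat xs G ^\<^sub>m 3 = adj_mat xs G * adj_mat xs G * adj_mat xs G" "adj_mat xs G ^\<^sub>m 4 = (adj_mat xs G * adj_mat xs G) * (adj_mat xs G * adj_mat xs G)"
    using A_carrier by (simp_all add: numeral_eq_Suc assoc_mult_mat[of _ "length xs" "length xs" _ "length xs" _ "length xs"])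
  show "mtrace (adj_mat xs G ^\<^sub>m 1) = 0"
    unfolding p mtrace_def using A_carrier by (auto simp: A_index intro!: sum.neutral)
  have "mtrace (adj_mat xs G * adj_mat xs G) = (\<Sum>i<length xs. of_nat (deg (parcs G) (xs ! i)))"
    unfolding mtrace_def using A2_carrier by (auto simp: A2_index simp del: index_mult_mat intro!: sum.cong)
  then show "mtrace (adj_mat xs G ^\<^sub>m 2) = of_nat (card (parcs G))"
    unfolding p sum_nth[of "\<lambda>u. of_nat (deg (parcs G) u)"] by (simp flip: sum_deg)
  have "mtrace (adj_mat xs G * adj_mat xs G * adj_mat xs G) = (\<Sum>i<length xs. \<Sum>j<length xs. of_nat (if (xs ! i, xs ! j) \<in> parcs G then cod (parcs G) (xs ! i) (xs ! j) else 0))"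
    unfolding mtrace_mult[OF A2_carrier A_carrier] using E_commute
    by (intro sum.cong refl) (auto simp: A2_index A_index simp del: index_mult_mat)
  also have "\<dots> = (\<Sum>u\<in>pverts G. \<Sum>v\<in>pverts G. of_nat (if (u, v) \<in> parcs G then cod (parcs G) u v else 0))"
    by (simp only: sum_nth[of "\<lambda>v. of_nat (if (_, v) \<in> parcs G then cod (parcs G) _ v else 0)"]
        sum_nth[of "\<lambda>u. \<Sum>v\<in>pverts G. of_nat (if (u, v) \<in> parcs G then cod (parcs G) u v else 0)"])
  also have "\<dots> = of_nat (walks3 (parcs G))"
    unfolding walks3_def sum_arcs sum_nb of_nat_sum ..
  finally show "mtrace (adj_mat xs G ^\<^sub>m 3) = of_nat (walks3 (parcs G))" unfolding p .
  have "mtrace ((adj_mat xs G * adj_mat xs G) * (adj_mat xs G * adj_mat xs G)) = (\<Sum>i<length xs. \<Sum>j<length xs. of_nat ((cod (parcs G) (xs ! i) (xs ! j))\<^sup>2))"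
    unfolding mtrace_mult[OF A2_carrier A2_carrier]
    by (intro sum.cong refl) (auto simp: A2_index cod_commute power2_eq_square simp del: index_mult_mat)
  also have "\<dots> = (\<Sum>u\<in>pverts G. \<Sum>v\<in>pverts G. of_nat ((cod (parcs G) u v)\<^sup>2))"
    by (simp only: sum_nth[of "\<lambda>v. of_nat ((cod (parcs G) _ v)\<^sup>2)"]
        sum_nth[of "\<lambda>u. \<Sum>v\<in>pverts G. of_nat ((cod (parcs G) u v)\<^sup>2)"])
  also have "\<dots> = of_nat (walks4 (pverts G) (parcs G))"
    unfolding walks4_def of_nat_sum ..
  finally show "mtrace (adj_mat xs G ^\<^sub>m 4) = of_nat (walks4 (pverts G) (parcs G))" unfolding p .
qed

lemma obtain_spectrum:
  obtains ls :: "real list" where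
    "char_poly (adj_mat xs G) = (\<Prod>e\<leftarrow>map complex_of_real ls. [:- e, 1:])" "length ls = length xs"
    "energy G = (\<Sum>x\<leftarrow>ls. \<bar>x\<bar>)"
    "psum 1 ls = 0" "psum 2 ls = card (parcs G)" "psum 3 ls = walks3 (parcs G)" "psum 4 ls = walks4 (pverts G) (parcs G)"
proof -
  obtain es where es: "char_poly (adj_mat xs G) = (\<Prod>e\<leftarrow>es. [:- e, 1:])" "length es = length xs"
    using char_poly_factorized[OF A_carrier] by blast
  have "e \<in> \<real>" if "e \<in> set es" for e
  proof (rule symmetric_eigenvalue_real[OF A_carrier])
    have "poly (\<Prod>e\<leftarrow>es. [:- e, 1:]) e = 0" using that by (induction es) auto
    then show "eigenvalue (adj_mat xs G) e" using eigenvalue_root_char_poly[OF A_carrier] es by simp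
  qed (use E_sym in \<open>auto simp: A_index\<close>)
  then have Re: "map complex_of_real (map Re es) = es"
    by (auto intro!: map_idI simp: o_def)
  define ls where "ls = map Re es"
  have es_ls: "es = map complex_of_real ls" using Re unfolding ls_def by simp
  have ps: "complex_of_real (psum k ls) = mtrace (adj_mat xs G ^\<^sub>m k)" for k
    unfolding mtrace_pow[OF A_carrier es(1)] es_ls psum_def by (induction ls) auto
  have energy: "energy G = (\<Sum>x\<leftarrow>ls. \<bar>x\<bar>)"
    unfolding energy_eq[OF xs] mat_energy_eq[OF A_carrier es(1)] es_ls by (simp add: o_def)
  have ps_nat: "psum k ls = real c" if "mtrace (adj_mat xs G ^\<^sub>m k) = of_nat c" for k c
    using ps[of k] that by (metis of_real_eq_iff of_real_of_nat_eq)
  have ps': "psum 1 ls = 0" "psum 2 ls = card (parcs G)" "psum 3 ls = walks3 (parcs G)"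
    "psum 4 ls = walks4 (pverts G) (parcs G)"
    using ps_nat[of 1 0] ps_nat[of 2] ps_nat[of 3] ps_nat[of 4] mtrace_A_pow by simp_all
  have "char_poly (adj_mat xs G) = (\<Prod>e\<leftarrow>map complex_of_real ls. [:- e, 1:])" "length ls = length xs"
    using es unfolding es_ls[symmetric] by (simp_all add: ls_def)
  then show ?thesis using energy ps' by (rule that)
qed

end

text \<open>A vertex cover {a, b} gives a factorisation of the adjacency matrix through a four-dimensional space.\<close>

lemma adj_mat_two_cover:
  assumes G: "pair_graph G" and xs: "distinct xs" "set xs = pverts G" and ab: "a \<noteq> b"
    and cover: "\<And>u v. (u, v) \<in> parcs G \<Longrightarrow> u \<in> {a, b} \<or> v \<in> {a, b}"
  obtains U W where "U \<in> carrier_mat (length xs) 4" "W \<in> carrier_mat 4 (length xs)" "adj_mat xs G = U * W"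
proof -
  let ?n = "length xs" and ?E = "\<lambda>u v. (u, v) \<in> parcs G"
  define U :: "complex mat" where "U = mat ?n 4 (\<lambda>(i, k).
    if k = 0 then of_bool (xs ! i = a) else if k = 1 then of_bool (xs ! i = b)
    else if k = 2 then of_bool (xs ! i \<notin> {a, b} \<and> ?E (xs ! i) a) else of_bool (xs ! i \<notin> {a, b} \<and> ?E (xs ! i) b))"
  define W :: "complex mat" where "W = mat 4 ?n (\<lambda>(k, j).
    if k = 0 then of_bool (?E a (xs ! j)) else if k = 1 then of_bool (?E b (xs ! j))
    else if k = 2 then of_bool (xs ! j = a) else of_bool (xs ! j = b))"
  have carr: "U \<in> carrier_mat ?n 4" "W \<in> carrier_mat 4 ?n" unfolding U_def W_def by auto
  have "adj_mat xs G = U * W"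
  proof (rule eq_matI)
    fix i j assume "i < dim_row (U * W)" "j < dim_col (U * W)"
    then have ij: "i < ?n" "j < ?n" using carr by auto
    have "{0..<4} = {0, 1, 2, 3 :: nat}" by auto
    then have "(U * W) $$ (i, j) = (\<Sum>k\<in>{0, 1, 2, 3}. U $$ (i, k) * W $$ (k, j))"
      using ij carr by (auto simp: scalar_prod_def intro!: sum.cong)
    then show "adj_mat xs G $$ (i, j) = (U * W) $$ (i, j)"
      using ij ab cover[of "xs ! i" "xs ! j"] by (auto simp: U_def W_def adj_mat_def)
  qed (use carr in \<open>auto simp: adj_mat_def\<close>)
  then show ?thesis using that carr by blast
qed

section \<open>Comparison of energies\<close>

context
  fixes G :: "'a pair_pre_digraph"
  assumes G: "pair_graph G"
begin

lemma real_spectrum_graph: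
  obtains ls xs where
    "real_spectrum ls (energy G / 2) (card (parcs G)) (walks3 (parcs G)) (quad (pverts G) (parcs G))"
    "distinct xs" "set xs = pverts G" "length ls = length xs"
    "char_poly (adj_mat xs G) = (\<Prod>e\<leftarrow>map complex_of_real ls. [:- e, 1:])"
proof -
  interpret pair_graph G by (rule G)
  obtain xs where xs: "set xs = pverts G" "distinct xs"
    using finite_distinct_list[OF pair_finite_verts] by blast
  obtain ls where ls:
    "char_poly (adj_mat xs G) = (\<Prod>e\<leftarrow>map complex_of_real ls. [:- e, 1:])" "length ls = length xs"
    "energy G = (\<Sum>x\<leftarrow>ls. \<bar>x\<bar>)"
    "psum 1 ls = 0" "psum 2 ls = card (parcs G)" "psum 3 ls = walks3 (parcs G)" "psum 4 ls = walks4 (pverts G) (parcs G)"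
    using obtain_spectrum[OF G xs(2,1)] by blast
  have "real_spectrum ls (energy G / 2) (card (parcs G)) (walks3 (parcs G)) (quad (pverts G) (parcs G))"
    using ls by unfold_locales (simp_all add: quad_def)
  then show ?thesis using that xs ls by blast
qed

lemma energy_ge:
  defines "p \<equiv> energy G / 2" and "m \<equiv> real (card (parcs G)) / 2"
    and "T \<equiv> real (walks3 (parcs G))" and "Q \<equiv> real_of_int (quad (pverts G) (parcs G))"
  shows "0 \<le> p" "m \<le> p\<^sup>2" "T\<^sup>2 / 9 + p\<^sup>2 * Q / 2 \<le> p\<^sup>2 * (p\<^sup>2 - m)\<^sup>2"
proof -
  obtain ls xs where
    "real_spectrum ls (energy G / 2) (card (parcs G)) (walks3 (parcs G)) (quad (pverts G) (parcs G))"
    using real_spectrum_graph by metis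
  then interpret real_spectrum ls "energy G / 2" "card (parcs G)" "walks3 (parcs G)" "quad (pverts G) (parcs G)" .
  show "0 \<le> p" "m \<le> p\<^sup>2" "T\<^sup>2 / 9 + p\<^sup>2 * Q / 2 \<le> p\<^sup>2 * (p\<^sup>2 - m)\<^sup>2"
    unfolding assms using p_nonneg p_sq_ge master_ge by auto
qed

lemma energy_hub:
  assumes hub: "is_hub (pverts G) (parcs G) J k" and nonneg: "0 \<le> quad (pverts G) (parcs G)"
  defines "p \<equiv> energy G / 2" and "m \<equiv> real (card (parcs G)) / 2"
    and "T \<equiv> real (walks3 (parcs G))" and "Q \<equiv> real_of_int (quad (pverts G) (parcs G))"
  shows "T\<^sup>2 / 9 + p\<^sup>2 * Q / 2 = p\<^sup>2 * (p\<^sup>2 - m)\<^sup>2"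
proof -
  obtain ls xs where ls:
    "real_spectrum ls (energy G / 2) (card (parcs G)) (walks3 (parcs G)) (quad (pverts G) (parcs G))"
    "distinct xs" "set xs = pverts G" "length ls = length xs"
    "char_poly (adj_mat xs G) = (\<Prod>e\<leftarrow>map complex_of_real ls. [:- e, 1:])"
    using real_spectrum_graph by metis
  interpret real_spectrum ls "energy G / 2" "card (parcs G)" "walks3 (parcs G)" "quad (pverts G) (parcs G)"
    by (rule ls(1))
  obtain a b X where ab: "a \<noteq> b" "parcs G = hub_arcs (pverts G) a b X J" "X \<subseteq> pverts G - {a, b}"
    using hub unfolding is_hub_def by blast
  have cover: "u \<in> {a, b} \<or> v \<in> {a, b}" if "(u, v) \<in> parcs G" for u v
    using that unfolding ab(2) hub_arcs_def by auto
  obtain U W where UW: "U \<in> carrier_mat (length xs) 4" "W \<in> carrier_mat 4 (length xs)" "adj_mat xs G = U * W"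
    using adj_mat_two_cover[OF G ls(2,3) ab(1) cover] by blast
  have "length (filter (\<lambda>e. e \<noteq> 0) (map complex_of_real ls)) \<le> 4"
    using ls(4,5) unfolding UW(3) by (intro low_rank_nonzero_eigenvalues[OF UW(1,2)]) auto
  then have "length (filter (\<lambda>x. x \<noteq> 0) ls) \<le> 4" by (simp add: filter_map o_def)
  then show ?thesis unfolding assms(3-) using master_eq nonneg by simp
qed

end

text \<open>Here \<open>r\<close> belongs to the extremal graph and \<open>p\<close> to a competitor
  of no larger energy. The outcome compares only triangles and b_4, with the unknown
  \<open>p\<close> eliminated; the right side is monotone since \<open>p\<^sup>2\<close> and
  \<open>r\<^sup>2\<close> are at least \<open>m\<close>.\<close>

lemma compare_energy_equations:
  fixes p r m T S Q C :: real
  assumes "0 \<le> p" "p \<le> r" "0 < m" "m \<le> p\<^sup>2"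
    and p: "T\<^sup>2 / 9 + p\<^sup>2 * Q / 2 \<le> p\<^sup>2 * (p\<^sup>2 - m)\<^sup>2"
    and r: "S\<^sup>2 / 9 + r\<^sup>2 * C / 2 = r\<^sup>2 * (r\<^sup>2 - m)\<^sup>2"
  shows "2 * T\<^sup>2 + 9 * (r\<^sup>2 * Q) \<le> 2 * S\<^sup>2 + 9 * (r\<^sup>2 * C)"
    and "p < r \<Longrightarrow> 2 * T\<^sup>2 + 9 * (r\<^sup>2 * Q) < 2 * S\<^sup>2 + 9 * (r\<^sup>2 * C)"
proof -
  have p2: "0 < p\<^sup>2" using assms(3,4) by linarith
  have pr: "p\<^sup>2 \<le> r\<^sup>2" using assms(1,2) by (intro power_mono) auto
  then have r2: "0 < r\<^sup>2" using p2 by linarith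
  \<comment> \<open>Scaling the inequality for \<open>p\<close> by this factor turns every outer
    \<open>p\<^sup>2\<close> into \<open>r\<^sup>2\<close>; the triangle term only grows, because
    the factor is at least 1.\<close>
  define k where "k = r\<^sup>2 / p\<^sup>2"
  have k: "1 \<le> k" "k * p\<^sup>2 = r\<^sup>2" using p2 pr unfolding k_def by auto
  have "k * (T\<^sup>2 / 9 + p\<^sup>2 * Q / 2) \<le> k * (p\<^sup>2 * (p\<^sup>2 - m)\<^sup>2)"
    using p k by (intro mult_left_mono) auto
  then have "k * (T\<^sup>2 / 9) + (k * p\<^sup>2) * Q / 2 \<le> (k * p\<^sup>2) * (p\<^sup>2 - m)\<^sup>2"
    by (simp add: algebra_simps)
  moreover have "T\<^sup>2 / 9 \<le> k * (T\<^sup>2 / 9)" using k(1) by (simp add: mult_le_cancel_right1)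
  ultimately have a: "T\<^sup>2 / 9 + r\<^sup>2 * Q / 2 \<le> r\<^sup>2 * (p\<^sup>2 - m)\<^sup>2" unfolding k(2) by simp
  have "(p\<^sup>2 - m)\<^sup>2 \<le> (r\<^sup>2 - m)\<^sup>2" using assms(4) pr by (intro power_mono) auto
  then have "r\<^sup>2 * (p\<^sup>2 - m)\<^sup>2 \<le> r\<^sup>2 * (r\<^sup>2 - m)\<^sup>2" using r2 by simp
  then show "2 * T\<^sup>2 + 9 * (r\<^sup>2 * Q) \<le> 2 * S\<^sup>2 + 9 * (r\<^sup>2 * C)" using a r by simp
  assume "p < r"
  then have "p\<^sup>2 < r\<^sup>2" using assms(1) by (intro power_strict_mono) auto
  then have "(p\<^sup>2 - m)\<^sup>2 < (r\<^sup>2 - m)\<^sup>2" using assms(4) by (intro power_strict_mono) auto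
  then have "r\<^sup>2 * (p\<^sup>2 - m)\<^sup>2 < r\<^sup>2 * (r\<^sup>2 - m)\<^sup>2" using r2 by simp
  then show "2 * T\<^sup>2 + 9 * (r\<^sup>2 * Q) < 2 * S\<^sup>2 + 9 * (r\<^sup>2 * C)" using a r by simp
qed

section \<open>Edges, connectedness and isomorphism of pair graphs\<close>

lemma (in sgraph) card_uedges:
  assumes "pverts G = V" "parcs G = E"
  shows "card E = 2 * card (uedges G)"
proof -
  let ?f = "\<lambda>(u, v). {u, v}"
  have "card {p \<in> E. ?f p = e} = 2" if "e \<in> ?f ` E" for e
  proof -
    obtain u v where uv: "(u, v) \<in> E" "e = {u, v}" using \<open>e \<in> ?f ` E\<close> by auto
    then have "{p \<in> E. ?f p = e} = {(u, v), (v, u)}" using E_sym by (auto simp: doubleton_eq_iff)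
    moreover have "u \<noteq> v" using uv E_irr by auto
    ultimately show ?thesis by simp
  qed
  then have "(\<Sum>e\<in>?f ` E. card {p \<in> E. ?f p = e}) = (\<Sum>e\<in>?f ` E. 2)" by (intro sum.cong refl)
  then show ?thesis
    using sum.image_gen[OF finite_E, of "\<lambda>_. 1 :: nat" ?f] unfolding uedges_def assms by simp
qed

lemma (in sgraph) pair_graphI:
  assumes "pverts G = V" "parcs G = E" shows "pair_graph G"
  by unfold_locales (auto simp: assms symmetric_def sym_def dest: in_V intro: E_sym)

lemma connected_no_cut:
  assumes "Digraph_Component.connected (with_proj G)" "pair_graph G"
  shows "no_cut (pverts G) (parcs G)"
  unfolding no_cut_def
proof (intro allI impI, rule ccontr)
  interpret sgraph "pverts G" "parcs G" using assms(2) by (rule sgraph_pair_graph)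
  fix S assume S: "S \<subseteq> pverts G \<and> S \<noteq> {} \<and> S \<noteq> pverts G"
    and no: "\<not> (\<exists>u\<in>S. \<exists>v\<in>pverts G - S. (u, v) \<in> parcs G)"
  obtain u v where uv: "u \<in> S" "v \<in> pverts G" "v \<notin> S" using S by blast
  have "(u, v) \<in> rtrancl_on (pverts G) ((parcs G)\<^sup>s)"
    using assms(1) S uv unfolding connected_conv by auto
  then have "v \<in> S"
  proof (induction rule: rtrancl_on_induct)
    case (step y z)
    have "(y, z) \<in> parcs G" using step(2) E_sym by (auto simp: symcl_def)
    then show ?case using no step by blast
  qed (use uv in auto)
  then show False using uv by blast
qed

lemma connected_via:
  assumes "a \<in> pverts G" and reach: "\<And>u. u \<in> pverts G \<Longrightarrow> (u, a) \<in> rtrancl_on (pverts G) ((parcs G)\<^sup>s)"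
  shows "Digraph_Component.connected (with_proj G)"
proof -
  have "sym (rtrancl_on (pverts G) ((parcs G)\<^sup>s))"
    by (intro rtrancl_on_sym) (auto simp: symcl_def sym_def)
  then have "(u, v) \<in> rtrancl_on (pverts G) ((parcs G)\<^sup>s)" if "u \<in> pverts G" "v \<in> pverts G" for u v
    using reach[OF that(1)] reach[OF that(2)] by (meson rtrancl_on_trans symD)
  then show ?thesis using assms(1) unfolding connected_conv by auto
qed

lemma reach_arc:
  "(u, v) \<in> parcs G \<Longrightarrow> u \<in> pverts G \<Longrightarrow> v \<in> pverts G \<Longrightarrow> (u, v) \<in> rtrancl_on (pverts G) ((parcs G)\<^sup>s)"
  by (rule converse_rtrancl_on_into_rtrancl_on) (auto simp: symcl_def)

lemma conn_graphsD:
  assumes "G \<in> conn_graphs n (n + 2)"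
  shows "pair_graph G" "sgraph (pverts G) (parcs G)" "no_cut (pverts G) (parcs G)"
    "card (pverts G) = n" "card (parcs G) = 2 * n + 4"
proof -
  show G: "pair_graph G" "card (pverts G) = n" using assms unfolding conn_graphs_def by auto
  show s: "sgraph (pverts G) (parcs G)" using G(1) by (rule sgraph_pair_graph)
  show "no_cut (pverts G) (parcs G)" using assms connected_no_cut unfolding conn_graphs_def by blast
  show "card (parcs G) = 2 * n + 4"
    using sgraph.card_uedges[OF s, of G] assms unfolding conn_graphs_def by simp
qed

lemma hub_in_conn_graphs:
  assumes "finite (pverts G)" "card (pverts G) = n"
    and "is_hub (pverts G) (parcs G) True 3 \<or> is_hub (pverts G) (parcs G) False 4"
  shows "G \<in> conn_graphs n (n + 2)"
proof -
  obtain J k where hub: "is_hub (pverts G) (parcs G) J k" and k: "0 < k" using assms(3) by auto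
  interpret sgraph "pverts G" "parcs G" using assms(1) hub by (rule is_hub_sgraph)
  have "card (parcs G) = 2 * n + 4"
    using assms hub_True3_card hub_False4_card by metis
  then have "card (uedges G) = n + 2" using card_uedges[of G] by simp
  moreover have "Digraph_Component.connected (with_proj G)"
  proof -
    obtain a b X where h: "a \<in> pverts G" "b \<in> pverts G" "a \<noteq> b" "X \<subseteq> pverts G - {a, b}" "card X = k"
      "parcs G = hub_arcs (pverts G) a b X J"
      using hub unfolding is_hub_def by blast
    obtain x where x: "x \<in> X" using h(5) k by fastforce
    show ?thesis
    proof (rule connected_via[OF h(1)])
      fix u assume u: "u \<in> pverts G"
      consider "u = a" | "u = b" | "u \<noteq> a" "u \<noteq> b" by blast
      then show "(u, a) \<in> rtrancl_on (pverts G) ((parcs G)\<^sup>s)"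
      proof cases
        case 1 then show ?thesis using h by simp
      next
        case 2
        have "(b, x) \<in> parcs G" "(x, a) \<in> parcs G" using x h unfolding h(6) hub_arcs_def by auto
        then show ?thesis unfolding 2 using in_V by (meson reach_arc rtrancl_on_trans)
      next
        case 3
        then have "(u, a) \<in> parcs G" using u h unfolding h(6) hub_arcs_def by auto
        then show ?thesis using in_V reach_arc by metis
      qed
    qed
  qed
  ultimately show ?thesis unfolding conn_graphs_def using pair_graphI[of G] assms(2) by simp
qed

lemma ex_hub:
  fixes V :: "'a set"
  assumes "finite V" "k + 2 \<le> card V"
  shows "\<exists>E. is_hub V E J k"
proof -
  obtain S where S: "S \<subseteq> V" "card S = 2" using assms by (meson le_add2 le_trans obtain_subset_with_card_n)
  then obtain a b where ab: "S = {a, b}" "a \<noteq> b" by (auto simp: card_2_iff)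
  have "k \<le> card (V - {a, b})" using assms S ab by (simp add: card_Diff_subset)
  then obtain X where "X \<subseteq> V - {a, b}" "card X = k" by (meson obtain_subset_with_card_n)
  then have "is_hub V (hub_arcs V a b X J) J k" unfolding is_hub_def using S ab by blast
  then show ?thesis by blast
qed

text \<open>An isomorphism of digraphs also carries maps for arcs, heads and tails. For pair graphs
  heads and tails are the projections, so the vertex map determines the rest.\<close>

lemma isomorphic_iff:
  assumes H: "pair_graph H"
  shows "H \<simeq>\<^sub>G G \<longleftrightarrow>
    (\<exists>f. inj_on f (pverts H) \<and> pverts G = f ` pverts H \<and> parcs G = map_prod f f ` parcs H)"
proof
  assume "H \<simeq>\<^sub>G G"
  then obtain h where h: "pre_digraph.digraph_isomorphism (with_proj H) h" "with_proj G = app_iso h (with_proj H)"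
    unfolding isomorphic_def digraph_iso_def by blast
  have th: "iso_tail h = fst" "iso_head h = snd" "pverts G = iso_verts h ` pverts H" "parcs G = iso_arcs h ` parcs H"
    using h(2) unfolding with_proj_def app_iso_def by simp_all
  have "iso_arcs h e = map_prod (iso_verts h) (iso_verts h) e" if "e \<in> parcs H" for e
    using h(1) that unfolding pre_digraph.digraph_isomorphism_def by (cases e) (auto simp: th prod_eq_iff)
  then have "parcs G = map_prod (iso_verts h) (iso_verts h) ` parcs H" unfolding th(4) by (rule image_cong[OF refl])
  moreover have "inj_on (iso_verts h) (pverts H)"
    using h(1) unfolding pre_digraph.digraph_isomorphism_def by simp
  ultimately show "\<exists>f. inj_on f (pverts H) \<and> pverts G = f ` pverts H \<and> parcs G = map_prod f f ` parcs H"
    using th(3) by blast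
next
  interpret pair_graph H by (rule H)
  assume "\<exists>f. inj_on f (pverts H) \<and> pverts G = f ` pverts H \<and> parcs G = map_prod f f ` parcs H"
  then obtain f where f: "inj_on f (pverts H)" "pverts G = f ` pverts H" "parcs G = map_prod f f ` parcs H" by blast
  define h where "h = \<lparr>iso_verts = f, iso_arcs = map_prod f f, iso_head = snd, iso_tail = fst\<rparr>"
  have "inj_on (map_prod f f) (parcs H)"
    using map_prod_inj_on[OF f(1) f(1)] by (rule inj_on_subset) (auto dest: in_arcsD1 in_arcsD2)
  then have "pre_digraph.digraph_isomorphism (with_proj H) h"
    unfolding pre_digraph.digraph_isomorphism_def using f(1) wf_digraph by (auto simp: h_def)
  moreover have "with_proj G = app_iso h (with_proj H)"
    unfolding with_proj_def app_iso_def h_def using f by simp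
  ultimately show "H \<simeq>\<^sub>G G" unfolding isomorphic_def digraph_iso_def by blast
qed

lemma image_hub_arcs:
  assumes "inj_on f V" "a \<in> V" "b \<in> V" "X \<subseteq> V"
  shows "map_prod f f ` hub_arcs V a b X J = hub_arcs (f ` V) (f a) (f b) (f ` X) J"
proof -
  have eq: "f x = f y \<longleftrightarrow> x = y" if "x \<in> V" "y \<in> V" for x y
    using inj_on_eq_iff[OF assms(1)] that by blast
  have X: "f x \<in> f ` X \<longleftrightarrow> x \<in> X" if "x \<in> V" for x
    using assms(1,4) that by (auto dest: inj_onD)
  have arc: "(f u, f v) \<in> hub_arcs (f ` V) (f a) (f b) (f ` X) J \<longleftrightarrow> (u, v) \<in> hub_arcs V a b X J"
    if "u \<in> V" "v \<in> V" for u v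
    using that assms(2,3) by (simp add: hub_arcs_def eq X doubleton_eq_iff)
  have sub: "hub_arcs V a b X J \<subseteq> V \<times> V" for V :: "'c set" and a b X
    by (auto simp: hub_arcs_def)
  show ?thesis
  proof (intro subset_antisym subrelI)
    fix x y assume "(x, y) \<in> map_prod f f ` hub_arcs V a b X J"
    then show "(x, y) \<in> hub_arcs (f ` V) (f a) (f b) (f ` X) J" using arc sub by fastforce
  next
    fix x y assume xy: "(x, y) \<in> hub_arcs (f ` V) (f a) (f b) (f ` X) J"
    then obtain u v where "x = f u" "y = f v" "u \<in> V" "v \<in> V" unfolding hub_arcs_def by auto
    then show "(x, y) \<in> map_prod f f ` hub_arcs V a b X J" using arc[of u v] xy by force
  qed
qed

text \<open>Translates isomorphism to the labelled graphs on {0..<n} into \<open>is_hub\<close>,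
  which makes sense on any vertex set and is what the induction and the equality cases
  produce.\<close>

lemma isomorphic_hub_iff:
  assumes H: "pair_graph H" "pverts H = {0..<n}" "parcs H = hub_arcs {0..<n} 0 1 {2..<k + 2} J" and n: "k + 2 \<le> n"
  shows "H \<simeq>\<^sub>G G \<longleftrightarrow> finite (pverts G) \<and> card (pverts G) = n \<and> is_hub (pverts G) (parcs G) J k"
  unfolding isomorphic_iff[OF H(1)] H(2,3)
proof
  assume "\<exists>f. inj_on f {0..<n} \<and> pverts G = f ` {0..<n} \<and> parcs G = map_prod f f ` hub_arcs {0..<n} 0 1 {2..<k + 2} J"
  then obtain f where f: "inj_on f {0..<n}" "pverts G = f ` {0..<n}"
    "parcs G = map_prod f f ` hub_arcs {0..<n} 0 1 {2..<k + 2} J" by blast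
  have E: "parcs G = hub_arcs (pverts G) (f 0) (f 1) (f ` {2..<k + 2}) J"
    unfolding f(2,3) using f(1) n by (intro image_hub_arcs) auto
  have "card (f ` {2..<k + 2}) = k" using inj_on_subset[OF f(1), of "{2..<k + 2}"] n by (simp add: card_image)
  moreover have "f 0 \<noteq> f 1" "f ` {2..<k + 2} \<subseteq> pverts G - {f 0, f 1}"
    using f(1) n unfolding f(2) by (auto dest!: inj_onD)
  ultimately have "is_hub (pverts G) (parcs G) J k"
    unfolding is_hub_def using E f(2) n
    by (intro exI[of _ "f 0"] exI[of _ "f 1"] exI[of _ "f ` {2..<k + 2}"]) auto
  then show "finite (pverts G) \<and> card (pverts G) = n \<and> is_hub (pverts G) (parcs G) J k"
    using f(1,2) by (simp add: card_image)
next
  assume G: "finite (pverts G) \<and> card (pverts G) = n \<and> is_hub (pverts G) (parcs G) J k"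
  then obtain a b X where h: "a \<in> pverts G" "b \<in> pverts G" "a \<noteq> b" "X \<subseteq> pverts G - {a, b}" "card X = k"
    "parcs G = hub_arcs (pverts G) a b X J"
    unfolding is_hub_def by blast
  have finX: "finite X" using h(4) G finite_subset by auto
  obtain g where g: "bij_betw g {2..<k + 2} X"
    using finX h(5) by (metis add_diff_cancel_right' card_atLeastLessThan finite_atLeastLessThan finite_same_card_bij)
  have "card (pverts G - ({a, b} \<union> X)) = n - (k + 2)"
    using G h finX by (subst card_Diff_subset) (auto simp: card_insert_if)
  then obtain g' where g': "bij_betw g' {k + 2..<n} (pverts G - ({a, b} \<union> X))"
    using G by (metis card_atLeastLessThan finite_Diff finite_atLeastLessThan finite_same_card_bij)
  \<comment> \<open>The hubs, the set \<open>X\<close> and the remaining vertices are matched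
    separately with 0 and 1, the next k labels and the rest.\<close>
  define f where "f i = (if i = 0 then a else if i = 1 then b else if i < k + 2 then g i else g' i)" for i :: nat
  have "bij_betw f {2..<k + 2} X" by (rule bij_betw_cong[THEN iffD1, OF _ g]) (auto simp: f_def)
  moreover have "bij_betw f {k + 2..<n} (pverts G - ({a, b} \<union> X))"
    by (rule bij_betw_cong[THEN iffD1, OF _ g']) (auto simp: f_def)
  moreover have "bij_betw f {0, 1} {a, b}" using h(3) by (auto simp: bij_betw_def f_def)
  ultimately have "bij_betw f ({0, 1} \<union> {2..<k + 2} \<union> {k + 2..<n}) ({a, b} \<union> X \<union> (pverts G - ({a, b} \<union> X)))"
    using h(4) by (intro bij_betw_combine) auto
  moreover have "{0, 1} \<union> {2..<k + 2} \<union> {k + 2..<n} = {0..<n}" using n by auto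
  moreover have "{a, b} \<union> X \<union> (pverts G - ({a, b} \<union> X)) = pverts G" using h by auto
  ultimately have f: "bij_betw f {0..<n} (pverts G)" by simp
  have fX: "f ` {2..<k + 2} = X" using \<open>bij_betw f {2..<k + 2} X\<close> by (simp add: bij_betw_def)
  have "map_prod f f ` hub_arcs {0..<n} 0 1 {2..<k + 2} J = hub_arcs (f ` {0..<n}) (f 0) (f 1) (f ` {2..<k + 2}) J"
    using f n by (intro image_hub_arcs) (auto simp: bij_betw_def)
  also have "\<dots> = parcs G" using f unfolding fX h(6) by (simp add: bij_betw_def f_def)
  finally show "\<exists>f. inj_on f {0..<n} \<and> pverts G = f ` {0..<n} \<and> parcs G = map_prod f f ` hub_arcs {0..<n} 0 1 {2..<k + 2} J"
    using f by (intro exI[of _ f]) (simp add: bij_betw_def)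
qed

lemma S_graph_isomorphic_iff:
  assumes "5 \<le> n"
  shows "S_graph n (n + 2) \<simeq>\<^sub>G G \<longleftrightarrow>
    finite (pverts G) \<and> card (pverts G) = n \<and> is_hub (pverts G) (parcs G) True 3"
proof (rule isomorphic_hub_iff)
  show "parcs (S_graph n (n + 2)) = hub_arcs {0..<n} 0 1 {2..<3 + 2} True"
    using assms unfolding S_graph_def graph_of_def hub_arcs_def by (auto simp: doubleton_eq_iff)
  show "pair_graph (S_graph n (n + 2))" unfolding S_graph_def by (rule pair_graph_graph_of)
qed (use assms in \<open>simp_all add: S_graph_def graph_of_def\<close>)

lemma B_graph_isomorphic_iff:
  assumes "6 \<le> n"
  shows "B_graph n (n + 2) \<simeq>\<^sub>G G \<longleftrightarrow>
    finite (pverts G) \<and> card (pverts G) = n \<and> is_hub (pverts G) (parcs G) False 4"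
proof (rule isomorphic_hub_iff)
  show "parcs (B_graph n (n + 2)) = hub_arcs {0..<n} 0 1 {2..<4 + 2} False"
    using assms unfolding B_graph_def graph_of_def hub_arcs_def by auto
  show "pair_graph (B_graph n (n + 2))" unfolding B_graph_def by (rule pair_graph_graph_of)
qed (use assms in \<open>simp_all add: B_graph_def graph_of_def\<close>)

text \<open>The last two conclusions keep a lower bound and an exact cubic equation for
  \<open>r\<^sup>2\<close>; the numerical comparisons draw on these.\<close>

lemma energy_le_hub:
  assumes G: "G \<in> conn_graphs n (n + 2)" and hub: "is_hub (pverts G) (parcs G) J k"
    and nonneg: "0 \<le> quad (pverts G) (parcs G)"
    and H: "H \<in> conn_graphs n (n + 2)" and le: "energy H \<le> energy G"
  defines "r \<equiv> energy G / 2"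
    and "T \<equiv> real (walks3 (parcs H))" and "Q \<equiv> real_of_int (quad (pverts H) (parcs H))"
    and "S \<equiv> real (walks3 (parcs G))" and "C \<equiv> real_of_int (quad (pverts G) (parcs G))"
  shows "2 * T\<^sup>2 + 9 * (r\<^sup>2 * Q) \<le> 2 * S\<^sup>2 + 9 * (r\<^sup>2 * C)"
    and "energy H < energy G \<Longrightarrow> 2 * T\<^sup>2 + 9 * (r\<^sup>2 * Q) < 2 * S\<^sup>2 + 9 * (r\<^sup>2 * C)"
    and "real n + 2 \<le> r\<^sup>2" and "S\<^sup>2 / 9 + r\<^sup>2 * C / 2 = r\<^sup>2 * (r\<^sup>2 - (real n + 2))\<^sup>2"
proof -
  note GD = conn_graphsD[OF G] and HD = conn_graphsD[OF H]
  have m: "real (card (parcs G)) / 2 = real n + 2" "real (card (parcs H)) / 2 = real n + 2"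
    using GD(5) HD(5) by simp_all
  show r: "real n + 2 \<le> r\<^sup>2" "S\<^sup>2 / 9 + r\<^sup>2 * C / 2 = r\<^sup>2 * (r\<^sup>2 - (real n + 2))\<^sup>2"
    using energy_ge(2)[OF GD(1)] energy_hub[OF GD(1) hub nonneg] unfolding m r_def S_def C_def by auto
  have p: "0 \<le> energy H / 2" "real n + 2 \<le> (energy H / 2)\<^sup>2"
    "T\<^sup>2 / 9 + (energy H / 2)\<^sup>2 * Q / 2 \<le> (energy H / 2)\<^sup>2 * ((energy H / 2)\<^sup>2 - (real n + 2))\<^sup>2"
    using energy_ge[OF HD(1)] unfolding m T_def Q_def by auto
  note cmp = compare_energy_equations[OF p(1) _ _ p(2,3) r(2)]
  show "2 * T\<^sup>2 + 9 * (r\<^sup>2 * Q) \<le> 2 * S\<^sup>2 + 9 * (r\<^sup>2 * C)"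
    using le by (intro cmp(1)) (simp_all add: r_def)
  show "2 * T\<^sup>2 + 9 * (r\<^sup>2 * Q) < 2 * S\<^sup>2 + 9 * (r\<^sup>2 * C)" if "energy H < energy G"
    using that by (intro cmp(2)) (simp_all add: r_def)
qed

text \<open>A smaller energy of \<open>H\<close> would make the strict comparison hold between equal
  quantities. This gives equal energies within a family without computing any spectrum.\<close>

lemma energy_hub_unique:
  assumes "G \<in> conn_graphs n (n + 2)" "is_hub (pverts G) (parcs G) J k" "0 \<le> quad (pverts G) (parcs G)"
    and "H \<in> conn_graphs n (n + 2)" "walks3 (parcs H) = walks3 (parcs G)"
    "quad (pverts H) (parcs H) = quad (pverts G) (parcs G)"
  shows "energy G \<le> energy H"
  using energy_le_hub(2)[OF assms(1-4)] assms(5,6) by force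

text \<open>A competitor with a dominating vertex cannot have fewer triangles or a smaller b_4, so
  equality holds in both and \<open>cone_equality\<close> applies. For any other competitor the
  larger b_4 outweighs the triangles of S.\<close>

lemma energy_le_S:
  fixes G H :: "'a pair_pre_digraph"
  assumes G: "G \<in> conn_graphs n (n + 2)" and hub: "is_hub (pverts G) (parcs G) True 3"
    and H: "H \<in> conn_graphs n (n + 2)" and le: "energy H \<le> energy G"
    and n: "n = 5 \<or> 10 \<le> n \<or> n = 6 \<and> \<not> is_hub (pverts H) (parcs H) False 4"
  shows "is_hub (pverts H) (parcs H) True 3"
proof -
  note GD = conn_graphsD[OF G] and HD = conn_graphsD[OF H]
  interpret H: sgraph "pverts H" "parcs H" by (rule HD(2))
  have C: "quad (pverts G) (parcs G) = 24 * (int n - 5)" and S: "walks3 (parcs G) = 18"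
    using hub_True3_quad[OF _ hub] hub_True3_walks3[OF _ hub] sgraph.finite_V[OF GD(2)] GD(4) by auto
  define r2 where "r2 = (energy G / 2)\<^sup>2"
  define Q where "Q = quad (pverts H) (parcs H)"
  define T where "T = walks3 (parcs H)"
  have "0 \<le> quad (pverts G) (parcs G)" using n C by auto
  note E = energy_le_hub[OF G hub this H le, folded r2_def Q_def T_def, unfolded C S, simplified]
  have r2: "real n + 2 \<le> r2" by (rule E(3))
  \<comment> \<open>The constant is 2 * 18^2, from the three triangles of S.\<close>
  have cmp: "2 * (real T)\<^sup>2 + 9 * (r2 * (Q - 24 * (int n - 5))) \<le> 648"
    using E(1) by (simp add: algebra_simps)
  show ?thesis
  proof (cases "cone (pverts H) (parcs H)")
    case True
    then obtain z where "coned (pverts H) (parcs H) z" using H.coned_if_cone HD by auto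
    then interpret C: coned "pverts H" "parcs H" z .
    have T: "18 \<le> T" using C.walks3_cone unfolding T_def by simp
    have Q: "24 * (int n - 5) \<le> Q" using C.quad_cone_ge HD(4) unfolding Q_def by simp
    have T2: "324 \<le> (real T)\<^sup>2" using power_mono[of 18 "real T" 2] T by simp
    have pos: "0 \<le> r2 * (Q - 24 * (int n - 5))" using Q r2 by (intro mult_nonneg_nonneg) auto
    have "r2 * (Q - 24 * (int n - 5)) = 0" using cmp T2 pos by linarith
    then have "Q = 24 * (int n - 5)" using r2 by auto
    moreover have "(real T)\<^sup>2 \<le> 18\<^sup>2" using cmp pos by simp
    then have "real T \<le> 18" by (rule power2_le_imp_le) simp
    then have "T = 18" using T by simp
    ultimately show ?thesis using C.cone_equality HD(4) unfolding Q_def T_def by simp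
  next
    case False
    \<comment> \<open>The threshold is 648 / 9 = 72. The excess d is 16 with \<open>r2\<close> \<ge>
      7 at order 5, at least 8 (n - 9) \<ge> 8 with \<open>r2\<close> \<ge> 12 from order 10 on, and
      at least 8 at order 6.\<close>
    have "\<exists>d :: int. d \<le> Q - 24 * (int n - 5) \<and> 72 < r2 * d"
    proof -
      consider "n = 5" | "10 \<le> n" | "n = 6" "\<not> is_hub (pverts H) (parcs H) False 4" using n by blast
      then show ?thesis
      proof cases
        case 1
        then have "Q = 16" using H.quad_order5 HD False unfolding Q_def by simp
        then show ?thesis using 1 r2 by (intro exI[of _ 16]) auto
      next
        case 2
        have "32 * (int n - 6) \<le> Q"
          using quad_not_cone[OF _ HD(2,3) _ False] hub_False4_quad[OF H.finite_V] HD 2 unfolding Q_def by force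
        then show ?thesis using 2 r2 by (intro exI[of _ 8]) auto
      next
        case 3
        then have "32 \<le> Q" using quad_order6[OF HD(2,3) _ _ False] HD unfolding Q_def by auto
        \<comment> \<open>The general bound is only \<open>r2\<close> \<ge> 8. If \<open>r2\<close>
          were at most 9, the right side of the equation 36 + 12 r2 = r2 (r2 - 8)^2 would be at most
          9 and the left side at least 132.\<close>
        moreover have "9 < r2"
        proof (rule ccontr)
          assume "\<not> 9 < r2"
          then have "(r2 - 8)\<^sup>2 \<le> 1\<^sup>2" using r2 3 by (intro power_mono) auto
          then have "r2 * (r2 - 8)\<^sup>2 \<le> 9 * 1"
            using r2 3 \<open>\<not> 9 < r2\<close> by (intro mult_mono) auto
          moreover have "36 + r2 * 12 = r2 * (r2 - 8)\<^sup>2" using E(4) 3 by simp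
          ultimately show False using r2 by simp
        qed
        ultimately show ?thesis using 3 by (intro exI[of _ 8]) auto
      qed
    qed
    then obtain d :: int where d: "d \<le> Q - 24 * (int n - 5)" "72 < r2 * d" by blast
    have "r2 * d \<le> r2 * (Q - 24 * (int n - 5))" using d(1) r2 by (intro mult_left_mono) (auto simp flip: of_int_le_iff)
    then have "72 < r2 * (Q - 24 * (int n - 5))" using d(2) by linarith
    then show ?thesis using cmp zero_le_power2[of "real T"] by linarith
  qed
qed

lemma energy_le_B:
  fixes G H :: "'a pair_pre_digraph"
  assumes G: "G \<in> conn_graphs n (n + 2)" and hub: "is_hub (pverts G) (parcs G) False 4"
    and H: "H \<in> conn_graphs n (n + 2)" and le: "energy H \<le> energy G" and n: "6 \<le> n" "n \<le> 9"
  shows "is_hub (pverts H) (parcs H) False 4"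
proof (rule ccontr)
  assume no: "\<not> ?thesis"
  note GD = conn_graphsD[OF G] and HD = conn_graphsD[OF H]
  interpret H: sgraph "pverts H" "parcs H" by (rule HD(2))
  have C: "quad (pverts G) (parcs G) = 32 * (int n - 6)" and S: "walks3 (parcs G) = 0"
    using hub_False4_quad[OF _ hub] hub_False4_walks3[OF _ hub] sgraph.finite_V[OF GD(2)] GD(4) by auto
  define r2 where "r2 = (energy G / 2)\<^sup>2"
  define Q where "Q = quad (pverts H) (parcs H)"
  define T where "T = walks3 (parcs H)"
  have "0 \<le> quad (pverts G) (parcs G)" using n C by auto
  note E = energy_le_hub[OF G hub this H le, folded r2_def Q_def T_def, unfolded C S, simplified]
  have r2: "real n + 2 \<le> r2" by (rule E(3))
  have cmp: "2 * (real T)\<^sup>2 + 9 * (r2 * (Q - 32 * (int n - 6))) \<le> 0"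
    using E(1) by (simp add: algebra_simps)
  show False
  proof (cases "cone (pverts H) (parcs H)")
    case True
    then obtain z where "coned (pverts H) (parcs H) z" using H.coned_if_cone HD by auto
    then interpret C: coned "pverts H" "parcs H" z .
    have T: "0 < (real T)\<^sup>2" using C.walks3_cone unfolding T_def by simp
    have "24 * (int n - 5) \<le> Q" using C.quad_cone_ge HD(4) unfolding Q_def by simp
    \<comment> \<open>This is where n \<le> 9 enters: 24 (n - 5) - 32 (n - 6) = 8 (9 - n). At n = 9
      the difference is zero, and the triangles at the dominating vertex give the
      contradiction.\<close>
    then have "0 \<le> r2 * (Q - 32 * (int n - 6))" using n r2 by (intro mult_nonneg_nonneg) auto
    then show False using cmp T by linarith
  next
    case False
    have "32 * (int n - 6) < Q"
      using quad_not_cone[OF _ HD(2,3) _ False] HD n no unfolding Q_def by simp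
    then have "0 < r2 * (Q - 32 * (int n - 6))" using r2 by (intro mult_pos_pos) auto
    then show False using cmp zero_le_power2[of "real T"] by linarith
  qed
qed

text \<open>Energies are compared within the vertex type of G, so a graph of class I has to be found there.\<close>

lemma minimal_energy_iff:
  fixes I :: "'a pair_pre_digraph \<Rightarrow> bool"
  assumes conn: "\<And>G. I G \<Longrightarrow> G \<in> conn_graphs n e"
    and ex: "\<And>G :: 'a pair_pre_digraph. G \<in> conn_graphs n e \<Longrightarrow> \<exists>G'. I G'"
    and le: "\<And>G H. I G \<Longrightarrow> H \<in> conn_graphs n e \<Longrightarrow> energy H \<le> energy G \<Longrightarrow> I H"
    and eq: "\<And>G H. I G \<Longrightarrow> I H \<Longrightarrow> energy G \<le> energy H"
  shows "minimal_energy n e G \<longleftrightarrow> I G"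
proof
  assume min: "minimal_energy n e G"
  then have G: "G \<in> conn_graphs n e" by (simp add: minimal_energy_def is_arg_min_def)
  obtain G' where G': "I G'" using ex[OF G] by blast
  have "\<not> energy G' < energy G"
    using min conn[OF G'] by (auto simp: minimal_energy_def is_arg_min_def)
  then show "I G" using le[OF G' G] by simp
next
  assume G: "I G"
  have "\<not> energy H < energy G" if "H \<in> conn_graphs n e" for H :: "'a pair_pre_digraph"
    using le[OF G that] eq[OF G, of H] by fastforce
  then show "minimal_energy n e G"
    using conn[OF G] by (auto simp: minimal_energy_def is_arg_min_def)
qed

lemma minimal_energy_S_iff:
  fixes G :: "'a pair_pre_digraph"
  assumes n: "n = 5 \<or> 10 \<le> n"
  shows "minimal_energy n (n + 2) G \<longleftrightarrow> S_graph n (n + 2) \<simeq>\<^sub>G G"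
proof (rule minimal_energy_iff)
  have n5: "5 \<le> n" using n by auto
  note iso = S_graph_isomorphic_iff[OF n5]
  show conn: "G \<in> conn_graphs n (n + 2)" if "S_graph n (n + 2) \<simeq>\<^sub>G G" for G :: "'a pair_pre_digraph"
    using that hub_in_conn_graphs unfolding iso by blast
  show "\<exists>G'. S_graph n (n + 2) \<simeq>\<^sub>G (G' :: 'a pair_pre_digraph)" if "G \<in> conn_graphs n (n + 2)" for G :: "'a pair_pre_digraph"
  proof -
    note GD = conn_graphsD[OF that]
    have fin: "finite (pverts G)" using GD(2) by (rule sgraph.finite_V)
    obtain E where "is_hub (pverts G) E True 3" using ex_hub[OF fin, of 3 True] n5 GD(4) by auto
    then show ?thesis unfolding iso using fin GD(4) by (intro exI[of _ "\<lparr>pverts = pverts G, parcs = E\<rparr>"]) simp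
  qed
  show "S_graph n (n + 2) \<simeq>\<^sub>G H"
    if "S_graph n (n + 2) \<simeq>\<^sub>G G" "H \<in> conn_graphs n (n + 2)" "energy H \<le> energy G" for G H :: "'a pair_pre_digraph"
    using energy_le_S[OF conn[OF that(1)] _ that(2,3)] that n conn_graphsD[OF that(2)] sgraph.finite_V
    unfolding iso by blast
  show "energy G \<le> energy H" if "S_graph n (n + 2) \<simeq>\<^sub>G G" "S_graph n (n + 2) \<simeq>\<^sub>G H" for G H :: "'a pair_pre_digraph"
  proof -
    have hubs: "finite (pverts G)" "card (pverts G) = n" "is_hub (pverts G) (parcs G) True 3"
      "finite (pverts H)" "card (pverts H) = n" "is_hub (pverts H) (parcs H) True 3"
      using that unfolding iso by blast+
    show ?thesis
    proof (rule energy_hub_unique[OF conn[OF that(1)] hubs(3) _ conn[OF that(2)]])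
      show "0 \<le> quad (pverts G) (parcs G)"
        using hub_True3_quad[OF hubs(1,3)] hubs(2) n5 by simp
      show "walks3 (parcs H) = walks3 (parcs G)"
        using hub_True3_walks3[OF hubs(1,3)] hub_True3_walks3[OF hubs(4,6)] by simp
      show "quad (pverts H) (parcs H) = quad (pverts G) (parcs G)"
        using hub_True3_quad[OF hubs(1,3)] hub_True3_quad[OF hubs(4,6)] hubs(2,5) by simp
    qed
  qed
qed

lemma minimal_energy_B_iff:
  fixes G :: "'a pair_pre_digraph"
  assumes n: "6 \<le> n" "n \<le> 9"
  shows "minimal_energy n (n + 2) G \<longleftrightarrow> B_graph n (n + 2) \<simeq>\<^sub>G G"
proof (rule minimal_energy_iff)
  note iso = B_graph_isomorphic_iff[OF n(1)]
  show conn: "G \<in> conn_graphs n (n + 2)" if "B_graph n (n + 2) \<simeq>\<^sub>G G" for G :: "'a pair_pre_digraph"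
    using that hub_in_conn_graphs unfolding iso by blast
  show "\<exists>G'. B_graph n (n + 2) \<simeq>\<^sub>G (G' :: 'a pair_pre_digraph)" if "G \<in> conn_graphs n (n + 2)" for G :: "'a pair_pre_digraph"
  proof -
    note GD = conn_graphsD[OF that]
    have fin: "finite (pverts G)" using GD(2) by (rule sgraph.finite_V)
    obtain E where "is_hub (pverts G) E False 4" using ex_hub[OF fin, of 4 False] n GD(4) by auto
    then show ?thesis unfolding iso using fin GD(4) by (intro exI[of _ "\<lparr>pverts = pverts G, parcs = E\<rparr>"]) simp
  qed
  show "B_graph n (n + 2) \<simeq>\<^sub>G H"
    if "B_graph n (n + 2) \<simeq>\<^sub>G G" "H \<in> conn_graphs n (n + 2)" "energy H \<le> energy G" for G H :: "'a pair_pre_digraph"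
    using energy_le_B[OF conn[OF that(1)] _ that(2,3) n] that conn_graphsD[OF that(2)] sgraph.finite_V
    unfolding iso by blast
  show "energy G \<le> energy H" if "B_graph n (n + 2) \<simeq>\<^sub>G G" "B_graph n (n + 2) \<simeq>\<^sub>G H" for G H :: "'a pair_pre_digraph"
  proof -
    have hubs: "finite (pverts G)" "card (pverts G) = n" "is_hub (pverts G) (parcs G) False 4"
      "finite (pverts H)" "card (pverts H) = n" "is_hub (pverts H) (parcs H) False 4"
      using that unfolding iso by blast+
    show ?thesis
    proof (rule energy_hub_unique[OF conn[OF that(1)] hubs(3) _ conn[OF that(2)]])
      show "0 \<le> quad (pverts G) (parcs G)"
        using hub_False4_quad[OF hubs(1,3)] hubs(2) n by simp
      show "walks3 (parcs H) = walks3 (parcs G)"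
        using hub_False4_walks3[OF hubs(1,3)] hub_False4_walks3[OF hubs(4,6)] by simp
      show "quad (pverts H) (parcs H) = quad (pverts G) (parcs G)"
        using hub_False4_quad[OF hubs(1,3)] hub_False4_quad[OF hubs(4,6)] hubs(2,5) by simp
    qed
  qed
qed

section \<open>The complete graph of order four and the second place at order six\<close>

lemma energy_complete:
  assumes "K\<^bsub>n\<^esub> (with_proj G)" "K\<^bsub>n\<^esub> (with_proj H)" shows "energy G = energy H"
proof -
  have G: "finite (pverts G)" "card (pverts G) = n" "parcs G = {(u, v). (u, v) \<in> pverts G \<times> pverts G \<and> u \<noteq> v}"
    and H: "finite (pverts H)" "card (pverts H) = n" "parcs H = {(u, v). (u, v) \<in> pverts H \<times> pverts H \<and> u \<noteq> v}"
    using assms unfolding complete_digraph_pair_def by blast+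
  obtain xs ys where xs: "distinct xs" "set xs = pverts G" and ys: "distinct ys" "set ys = pverts H"
    using finite_distinct_list G(1) H(1) by metis
  have len: "length xs = n" "length ys = n" using xs ys G(2) H(2) distinct_card by metis+
  have "adj_mat xs G = adj_mat ys H"
  proof (rule eq_matI)
    fix i j assume "i < dim_row (adj_mat ys H)" "j < dim_col (adj_mat ys H)"
    then have ij: "i < n" "j < n" using len by (auto simp: adj_mat_def)
    have "xs ! i \<in> pverts G" "xs ! j \<in> pverts G" "ys ! i \<in> pverts H" "ys ! j \<in> pverts H"
      using ij xs ys len nth_mem by metis+
    then show "adj_mat xs G $$ (i, j) = adj_mat ys H $$ (i, j)"
      using ij len xs(1) ys(1) unfolding adj_mat_def G(3) H(3) by (simp add: nth_eq_iff_index_eq)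
  qed (simp_all add: adj_mat_def len)
  then show ?thesis using energy_eq xs ys by metis
qed

lemma complete_graph_in_conn_graphs:
  assumes "K\<^bsub>4\<^esub> (with_proj G)" shows "G \<in> conn_graphs 4 (4 + 2)"
proof -
  have G: "finite (pverts G)" "card (pverts G) = 4" "parcs G = {(u, v). (u, v) \<in> pverts G \<times> pverts G \<and> u \<noteq> v}"
    using assms unfolding complete_digraph_pair_def by blast+
  have s: "sgraph (pverts G) (parcs G)"
    using G(1) by unfold_locales (auto simp: G(3))
  then interpret sgraph "pverts G" "parcs G" .
  have "deg (parcs G) u = 3" if "u \<in> pverts G" for u
  proof -
    have "nb (parcs G) u = pverts G - {u}" using that by (auto simp: G(3))
    then show ?thesis using that G(1,2) by (simp add: deg_def)
  qed
  then have "card (parcs G) = 12" using sum_deg G(2) by simp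
  then have "card (uedges G) = 6" using card_uedges[of G] by simp
  moreover obtain a where a: "a \<in> pverts G" using G(2) by fastforce
  have "Digraph_Component.connected (with_proj G)"
  proof (rule connected_via[OF a])
    fix u assume "u \<in> pverts G"
    then show "(u, a) \<in> rtrancl_on (pverts G) ((parcs G)\<^sup>s)"
      using a reach_arc[of u a G] by (cases "u = a") (auto simp: G(3))
  qed
  ultimately show ?thesis unfolding conn_graphs_def using pair_graphI[of G] G(2) by simp
qed

text \<open>Six edges on four vertices are all possible ones, so every competitor is complete and
  all energies agree.\<close>

lemma minimal_energy_order4_iff:
  fixes G :: "'a pair_pre_digraph"
  shows "minimal_energy 4 (4 + 2) G \<longleftrightarrow> K\<^bsub>4\<^esub> (with_proj G)"
proof -
  have complete: "K\<^bsub>4\<^esub> (with_proj G)" if "G \<in> conn_graphs 4 (4 + 2)" for G :: "'a pair_pre_digraph"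
  proof -
    note GD = conn_graphsD[OF that]
    have "parcs G = {(u, v). u \<in> pverts G \<and> v \<in> pverts G \<and> u \<noteq> v}"
      using order4_complete[OF GD(2)] GD(4,5) by simp
    then show ?thesis
      unfolding complete_digraph_pair_def using sgraph.finite_V[OF GD(2)] GD(4) by auto
  qed
  show ?thesis
  proof (rule minimal_energy_iff)
    show "energy G \<le> energy H" if "K\<^bsub>4\<^esub> (with_proj G)" "K\<^bsub>4\<^esub> (with_proj H)" for G H :: "'a pair_pre_digraph"
      using energy_complete[OF that] by simp
  qed (use complete complete_graph_in_conn_graphs in blast)+
qed

text \<open>Since the minimal graphs are exactly the copies of B, a competitor for the second place
  satisfies the extra condition of \<open>energy_le_S\<close> at order 6. That S is not itself
  minimal is seen from its triangles.\<close>

lemma second_minimal_energy_S_6_8: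
  fixes G :: "'a pair_pre_digraph"
  assumes "S_graph 6 8 \<simeq>\<^sub>G G"
  shows "second_minimal_energy 6 8 G"
proof -
  have min: "minimal_energy 6 8 H \<longleftrightarrow> finite (pverts H) \<and> card (pverts H) = 6 \<and> is_hub (pverts H) (parcs H) False 4"
    for H :: "'a pair_pre_digraph"
    using minimal_energy_B_iff[of 6 H] B_graph_isomorphic_iff[of 6 H] by simp
  have G: "finite (pverts G)" "card (pverts G) = 6" "is_hub (pverts G) (parcs G) True 3"
    using assms S_graph_isomorphic_iff[of 6 G] by simp_all
  have conn: "G \<in> conn_graphs 6 (6 + 2)" using hub_in_conn_graphs G by blast
  have w: "walks3 (parcs G) = 18" "quad (pverts G) (parcs G) = 24"
    using hub_True3_walks3[OF G(1,3)] hub_True3_quad[OF G(1,3)] G(2) by simp_all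
  have "\<not> minimal_energy 6 8 G" using hub_False4_walks3[OF G(1)] w(1) unfolding min by auto
  moreover have "\<not> energy H < energy G"
    if H: "H \<in> conn_graphs 6 8" "\<not> minimal_energy 6 8 H" for H :: "'a pair_pre_digraph"
  proof
    assume less: "energy H < energy G"
    have H': "H \<in> conn_graphs 6 (6 + 2)" using H(1) by simp
    note HD = conn_graphsD[OF H']
    have fin: "finite (pverts H)" using HD(2) by (rule sgraph.finite_V)
    have "\<not> is_hub (pverts H) (parcs H) False 4" using H(2) fin HD(4) unfolding min by blast
    then have hub: "is_hub (pverts H) (parcs H) True 3"
      using energy_le_S[OF conn G(3) H'] less by simp
    have "walks3 (parcs H) = 18" "quad (pverts H) (parcs H) = 24"
      using hub_True3_walks3[OF fin hub] hub_True3_quad[OF fin hub] HD(4) by simp_all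
    then have "energy G \<le> energy H" using energy_hub_unique[OF conn G(3) _ H'] w by simp
    then show False using less by simp
  qed
  ultimately show ?thesis
    unfolding second_minimal_energy_def is_arg_min_def using conn by auto
qed

theorem theorem1p7:
  "\<forall>(n :: nat) (G :: 'a pair_pre_digraph).
     (n = 4 \<longrightarrow> (minimal_energy n (n + 2) G \<longleftrightarrow> K\<^bsub>4\<^esub> (with_proj G))) \<and>
     (n = 5 \<or> n \<ge> 10 \<longrightarrow> (minimal_energy n (n + 2) G \<longleftrightarrow> S_graph n (n + 2) \<simeq>\<^sub>G G)) \<and>
     (6 \<le> n \<and> n \<le> 9 \<longrightarrow> (minimal_energy n (n + 2) G \<longleftrightarrow> B_graph n (n + 2) \<simeq>\<^sub>G G)) \<and>
     (S_graph 6 8 \<simeq>\<^sub>G G \<longrightarrow> second_minimal_energy 6 8 G)"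
  using minimal_energy_order4_iff minimal_energy_S_iff minimal_energy_B_iff second_minimal_energy_S_6_8
  by blast

end
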